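(* Let $\mathfrak C:X'Y'\to Z$ be a quantum multiple access channel (a quantum channel from $X'\otimes Y'$ to $Z$, finite-dimensional). Let $\mathcal X,\mathcal Y$ be finite sets, for each $x\in\mathcal X$ let $\sigma_x^{X'}$ be a state on $X'$ and for each $y\in\mathcal Y$ let $\sigma^{Y'}_y$ be a state on $Y'$, and let $p(x)p(y)$ be a product probability distribution on $\mathcal X\times\mathcal Y$. Let $$\rho^{XYZ}:=\sum_{x,y}p(x)p(y)|x,y\rangle\langle x,y|^{XY}\otimes\mathfrak C(\sigma^{X'}_x\otimes\sigma^{Y'}_y).$$ Let $0<\epsilon<1$ and $R_1,R_2$ satisfy $R_1\le I^\epsilon_H(X:YZ)_\rho-1-\log\frac1\epsilon$, $R_2\le I^\epsilon_H(Y:XZ)_\rho-1-\log\frac1\epsilon$, $R_1+R_2\le I^\epsilon_H(XY:Z)_\rho-1-\log\frac1\epsilon$. Then there exists an $(R_1,R_2,49\epsilon^{1/2})$-quantum MAC code for sending classical information through $\mathfrak C$.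
   Context: $I^\epsilon_H(X:YZ)_\rho:=D^\epsilon_H(\rho^{XYZ}\|\rho^X\otimes\rho^{YZ})$, $I^\epsilon_H(Y:XZ)_\rho:=D^\epsilon_H(\rho^{XYZ}\|\rho^Y\otimes\rho^{XZ})$, $I^\epsilon_H(XY:Z)_\rho:=D^\epsilon_H(\rho^{XYZ}\|\rho^{XY}\otimes\rho^Z)$, where $D^\epsilon_H(\alpha\|\beta):=\max_\Pi -\log_2\operatorname{Tr}[\Pi\beta]$ over POVM elements $0\le\Pi\le\mathbb 1$ with $\operatorname{Tr}[\Pi\alpha]\ge1-\epsilon$; logs are base 2. An $(R_1,R_2,\eta)$-quantum MAC code for classical information through $\mathfrak C$ consists of an encoding of each message $m_1\in[2^{R_1}]$ into a state $\alpha_{m_1}$ on $X'$, of each $m_2\in[2^{R_2}]$ into a state $\beta_{m_2}$ on $Y'$, and a POVM $\{\Lambda_{m_1,m_2}\}$ on $Z$ such that the average decoding error $2^{-(R_1+R_2)}\sum_{m_1,m_2}\operatorname{Tr}[(\mathbb 1-\Lambda_{m_1,m_2})\mathfrak C(\alpha_{m_1}\otimes\beta_{m_2})]$ is at most $\eta$. *)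

theory Defs
  imports Complex_Main "HOL-Library.Extended_Real"
begin

text \<open>Operators on a finite-dimensional Hilbert space with orthonormal basis indexed by
  a type 'i are represented by their matrices  'i => 'i => complex.\<close>
type_synonym 'i op = "'i \<Rightarrow> 'i \<Rightarrow> complex"

text \<open>Positive semidefinite on the span of the basis vectors in a finite index set S
  (over the complex numbers this includes hermiticity).\<close>
definition psd_on :: "'i set \<Rightarrow> 'i op \<Rightarrow> bool" where
  "psd_on S A \<longleftrightarrow> (\<forall>v :: 'i \<Rightarrow> complex.
      (\<Sum>i\<in>S. \<Sum>j\<in>S. cnj (v i) * A i j * v j) \<in> \<real> \<and>
      0 \<le> Re (\<Sum>i\<in>S. \<Sum>j\<in>S. cnj (v i) * A i j * v j))"

definition psd :: "('i::finite) op \<Rightarrow> bool" where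
  "psd A \<longleftrightarrow> psd_on UNIV A"

definition trace :: "('i::finite) op \<Rightarrow> complex" where
  "trace A = (\<Sum>i\<in>UNIV. A i i)"

definition density :: "('i::finite) op \<Rightarrow> bool" where
  "density A \<longleftrightarrow> psd A \<and> trace A = 1"

definition idop :: "'i op" where
  "idop i j = (if i = j then 1 else 0)"

definition opmult :: "('i::finite) op \<Rightarrow> 'i op \<Rightarrow> 'i op" where
  "opmult A B i j = (\<Sum>k\<in>UNIV. A i k * B k j)"

definition opminus :: "'i op \<Rightarrow> 'i op \<Rightarrow> 'i op" where
  "opminus A B i j = A i j - B i j"

definition tensor :: "'i op \<Rightarrow> 'j op \<Rightarrow> ('i \<times> 'j) op" where
  "tensor A B = (\<lambda>(i, j) (i', j'). A i i' * B j j')"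

definition proj :: "'i \<Rightarrow> 'i op" where
  "proj x i j = (if i = x \<and> j = x then 1 else 0)"

definition ptrace2 :: "('i \<times> 'j::finite) op \<Rightarrow> 'i op" where
  "ptrace2 A i i' = (\<Sum>j\<in>UNIV. A (i, j) (i', j))"

definition ptrace1 :: "('i::finite \<times> 'j) op \<Rightarrow> 'j op" where
  "ptrace1 A j j' = (\<Sum>i\<in>UNIV. A (i, j) (i, j'))"

text \<open>Quantum channels (CPTP maps) between finite-dimensional systems.
  Complete positivity: for every ancilla dimension n (ancilla basis {..<n}),
  id_n (x) C maps positive operators to positive operators.\<close>
definition completely_positive :: "(('i::finite) op \<Rightarrow> ('k::finite) op) \<Rightarrow> bool" where
  "completely_positive C \<longleftrightarrow> (\<forall>(n::nat) (A :: (nat \<times> 'i) op).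
      psd_on ({..<n} \<times> UNIV) A \<longrightarrow>
      psd_on ({..<n} \<times> UNIV) (\<lambda>(r, k) (r', k'). C (\<lambda>a b. A (r, a) (r', b)) k k'))"

definition quantum_channel :: "(('i::finite) op \<Rightarrow> ('k::finite) op) \<Rightarrow> bool" where
  "quantum_channel C \<longleftrightarrow>
     (\<forall>A B. C (\<lambda>i j. A i j + B i j) = (\<lambda>k l. C A k l + C B k l)) \<and>
     (\<forall>c A. C (\<lambda>i j. c * A i j) = (\<lambda>k l. c * C A k l)) \<and>
     (\<forall>A. trace (C A) = trace A) \<and>
     completely_positive C"

text \<open>Hypothesis-testing relative entropy (logs base 2); value +infinity if Tr[Pi beta] = 0.
  The supremum is attained (the paper writes max).\<close>
definition DH :: "real \<Rightarrow> ('i::finite) op \<Rightarrow> 'i op \<Rightarrow> ereal" where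
  "DH \<epsilon> \<alpha> \<beta> = (SUP \<Pi> \<in> {\<Pi>. psd \<Pi> \<and> psd (opminus idop \<Pi>) \<and>
                               Re (trace (opmult \<Pi> \<alpha>)) \<ge> 1 - \<epsilon>}.
       (if Re (trace (opmult \<Pi> \<beta>)) > 0 then ereal (- log 2 (Re (trace (opmult \<Pi> \<beta>))))
        else PInfty))"

definition mac_state :: "('x::finite \<Rightarrow> real) \<Rightarrow> ('y::finite \<Rightarrow> real) \<Rightarrow>
    ('x \<Rightarrow> 'a op) \<Rightarrow> ('y \<Rightarrow> 'b op) \<Rightarrow> (('a \<times> 'b) op \<Rightarrow> 'z op) \<Rightarrow> ('x \<times> 'y \<times> 'z) op" where
  "mac_state p q \<sigma>X \<sigma>Y C = (\<lambda>i j. \<Sum>x\<in>UNIV. \<Sum>y\<in>UNIV.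
      complex_of_real (p x * q y) * tensor (proj x) (tensor (proj y) (C (tensor (\<sigma>X x) (\<sigma>Y y)))) i j)"

definition IH_X_YZ :: "real \<Rightarrow> ('x::finite \<times> 'y::finite \<times> 'z::finite) op \<Rightarrow> ereal" where
  "IH_X_YZ \<epsilon> \<rho> = DH \<epsilon> \<rho> (tensor (ptrace2 \<rho>) (ptrace1 \<rho>))"

definition IH_Y_XZ :: "real \<Rightarrow> ('x::finite \<times> 'y::finite \<times> 'z::finite) op \<Rightarrow> ereal" where
  "IH_Y_XZ \<epsilon> \<rho> = (let \<rho>' = (\<lambda>(y, x, z) (y', x', z'). \<rho> (x, y, z) (x', y', z'))
                    in DH \<epsilon> \<rho>' (tensor (ptrace2 \<rho>') (ptrace1 \<rho>')))"

definition IH_XY_Z :: "real \<Rightarrow> ('x::finite \<times> 'y::finite \<times> 'z::finite) op \<Rightarrow> ereal" where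
  "IH_XY_Z \<epsilon> \<rho> = (let \<rho>' = (\<lambda>((x, y), z) ((x', y'), z'). \<rho> (x, y, z) (x', y', z'))
                    in DH \<epsilon> \<rho>' (tensor (ptrace2 \<rho>') (ptrace1 \<rho>')))"

text \<open>An (R1,R2,eta) quantum MAC code with M1 = 2^R1, M2 = 2^R2 messages
  (messages m1 < M1, m2 < M2).\<close>
definition mac_code :: "(('a::finite \<times> 'b::finite) op \<Rightarrow> ('z::finite) op) \<Rightarrow> nat \<Rightarrow> nat \<Rightarrow> real \<Rightarrow>
    (nat \<Rightarrow> 'a op) \<Rightarrow> (nat \<Rightarrow> 'b op) \<Rightarrow> (nat \<Rightarrow> nat \<Rightarrow> 'z op) \<Rightarrow> bool" where
  "mac_code C M1 M2 \<eta> \<alpha> \<beta> \<Lambda> \<longleftrightarrow>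
     (\<forall>m1<M1. density (\<alpha> m1)) \<and> (\<forall>m2<M2. density (\<beta> m2)) \<and>
     (\<forall>m1<M1. \<forall>m2<M2. psd (\<Lambda> m1 m2)) \<and>
     (\<forall>i j. (\<Sum>m1<M1. \<Sum>m2<M2. \<Lambda> m1 m2 i j) = idop i j) \<and>
     (1 / (real M1 * real M2)) * (\<Sum>m1<M1. \<Sum>m2<M2.
        Re (trace (opmult (opminus idop (\<Lambda> m1 m2)) (C (tensor (\<alpha> m1) (\<beta> m2)))))) \<le> \<eta>"

end

theory Submission
  imports "HOL-Probability.Product_PMF" "HOL-Library.Function_Algebras" Defs
begin

text \<open>
  A decoder has to reject three kinds of competitors: wrong first message, wrong second message,
  both wrong. The hypotheses give one test against each kind, but non-commuting tests have no
  intersection: the span of three rejection subspaces may come close to the correct signal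
  although each of them is far from it. Following Sen, the rejection subspaces are therefore
  tilted by a small angle \<open>\<delta>\<close> into fresh orthogonal directions, which makes their span well
  conditioned. Here the directions are indexed by the messages themselves. The signal of
  \<open>(m\<^sub>1, m\<^sub>2)\<close> is tilted along \<open>m\<^sub>1\<close> and \<open>m\<^sub>2\<close>; the rejection subspace against a wrong \<open>m\<^sub>1\<close> is tilted
  along \<open>m\<^sub>2\<close> and vice versa, and that against both wrong is not tilted. A competing test then
  sees a wrong signal with exactly the tilt of the matching rejection subspace, so that its error
  is at most \<open>1 + \<delta>\<^sup>2\<close> times that of the original test, while the correct signal is lost with
  probability \<open>O(\<epsilon> / \<delta>\<^sup>2)\<close>.

  The joint tests are applied one after the other; by a non-commutative union bound the failure
  probability is at most four times the sum of the individual ones. Undoing the tilt of the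
  signal costs \<open>O(\<delta>\<^sup>2)\<close>. All these are inequalities between quadratic forms valid for each
  codebook, so only the classical average over the codebooks remains. The choice \<open>\<delta>\<^sup>2 = 4 \<surd>\<epsilon>\<close>
  gives the bound.
\<close>

type_synonym 'i cvec = "'i \<Rightarrow> complex"

section \<open>Positive semidefinite sesquilinear forms\<close>

definition scaleC :: "complex \<Rightarrow> 'i cvec \<Rightarrow> 'i cvec" (infixr "*\<^sub>C" 75) where
  "c *\<^sub>C v = (\<lambda>i. c * v i)"

definition unit_vec :: "'i \<Rightarrow> 'i cvec" where
  "unit_vec i = (\<lambda>j. if j = i then 1 else 0)"

lemma scaleC_apply [simp]: "(c *\<^sub>C v) i = c * v i"
  by (simp add: scaleC_def)

lemma sum_fun_apply: "(\<Sum>k\<in>K. f k) i = (\<Sum>k\<in>K. f k i)"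
  by (induction K rule: infinite_finite_induct) auto

interpretation scaleC: vector_space_pair
  "scaleC :: complex \<Rightarrow> 'i cvec \<Rightarrow> _" "scaleC :: complex \<Rightarrow> 'j cvec \<Rightarrow> _"
  by unfold_locales (auto simp: fun_eq_iff algebra_simps)

abbreviation clinear :: "('i cvec \<Rightarrow> 'j \<Rightarrow> complex) \<Rightarrow> bool" where
  "clinear \<equiv> Vector_Spaces.linear scaleC scaleC"

lemma clinearI:
  assumes "\<And>u v. F (u + v) = F u + F v" "\<And>c v. F (c *\<^sub>C v) = c *\<^sub>C F v"
  shows "clinear F"
  using assms by (simp add: Vector_Spaces.linear_iff scaleC.vs1.vector_space_axioms)

lemma clinear_comp: "clinear F \<Longrightarrow> clinear G \<Longrightarrow> clinear (\<lambda>v. F (G v))"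
  using Vector_Spaces.linear_compose[of scaleC scaleC G scaleC F] by (simp add: comp_def)

lemma clinear_compl: "clinear F \<Longrightarrow> clinear (\<lambda>v. v - F v)"
  by (rule scaleC.linear_compose_sub[OF scaleC.vs1.linear_ident])

lemma sum_unit_vec:
  fixes v :: "'i::finite \<Rightarrow> complex"
  shows "(\<Sum>i\<in>UNIV. v i *\<^sub>C unit_vec i) = v"
  by (simp add: fun_eq_iff sum_fun_apply unit_vec_def if_distrib[of "\<lambda>x. _ * x"] cong: if_cong)

locale psd_form =
  fixes B :: "'i cvec \<Rightarrow> 'i cvec \<Rightarrow> complex"
  assumes add_right: "B u (v + w) = B u v + B u w"
    and scale_right: "B u (c *\<^sub>C v) = c * B u v"
    and cnj_commute: "cnj (B u v) = B v u"
    and nonneg: "0 \<le> Re (B v v)"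
begin

lemma add_left: "B (u + v) w = B u w + B v w"
  by (metis add_right cnj_commute complex_cnj_add)

lemma scale_left: "B (c *\<^sub>C u) v = cnj c * B u v"
  by (metis scale_right cnj_commute complex_cnj_mult)

lemma diff_right: "B u (v - w) = B u v - B u w"
  by (metis add_right add_diff_cancel_right' diff_add_cancel)

lemma diff_left: "B (u - v) w = B u w - B v w"
  by (metis add_left add_diff_cancel_right' diff_add_cancel)

lemma zero_right: "B u 0 = 0"
  using diff_right[of u 0 0] by simp

lemma zero_left: "B 0 u = 0"
  using diff_left[of 0 0 u] by simp

lemmas sesquilinear =
  add_left add_right diff_left diff_right scale_left scale_right zero_left zero_right

lemma sum_left: "B (\<Sum>k\<in>K. f k) v = (\<Sum>k\<in>K. B (f k) v)"
  using sum_comp_morphism[of "\<lambda>u. B u v" f K] by (simp add: add_left zero_left comp_def)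

lemma sum_right: "B v (\<Sum>k\<in>K. f k) = (\<Sum>k\<in>K. B v (f k))"
  using sum_comp_morphism[of "B v" f K] by (simp add: add_right zero_right comp_def)

lemma Im_diag: "Im (B v v) = 0"
  using arg_cong[OF cnj_commute[of v v], of Im] by simp

lemma diag_real: "B v v = complex_of_real (Re (B v v))"
  by (simp add: complex_eq_iff Im_diag)

lemma Re_commute: "Re (B u v) = Re (B v u)"
  by (metis cnj.simps(1) cnj_commute)

lemma mult_cnj_commute: "B u v * B v u = complex_of_real ((cmod (B u v))\<^sup>2)"
  using complex_norm_square[of "B u v"] by (simp add: cnj_commute)

lemma isotropic_left:
  assumes "Re (B e e) = 0"
  shows "B e v = 0"
proof (rule ccontr)
  define b where "b = B e v"
  define t where "t = (Re (B v v) + 1) / (2 * (cmod b)\<^sup>2)"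
  assume "B e v \<noteq> 0"
  then have "b \<noteq> 0" by (simp add: b_def)
  have "B e e = 0"
    using assms diag_real[of e] by simp
  have "B v e = cnj b"
    by (simp add: b_def cnj_commute)
  have "0 \<le> Re (B (v - (t * b) *\<^sub>C e) (v - (t * b) *\<^sub>C e))"
    by (rule nonneg)
  also have "B (v - (t * b) *\<^sub>C e) (v - (t * b) *\<^sub>C e) = B v v - 2 * of_real t * (b * cnj b)"
    using \<open>B e e = 0\<close> \<open>B v e = cnj b\<close> by (simp add: sesquilinear flip: b_def)
  also have "\<dots> = B v v - complex_of_real (2 * t * (cmod b)\<^sup>2)"
    by (simp flip: complex_norm_square)
  also have "Re \<dots> = -1"
    using \<open>b \<noteq> 0\<close> by (simp add: t_def field_simps)
  finally show False by simp
qed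

lemma two_Re_le_weighted:
  assumes "t > 0"
  shows "2 * Re (B u v) \<le> t * Re (B v v) + Re (B u u) / t"
proof -
  have "0 \<le> Re (B (u - of_real t *\<^sub>C v) (u - of_real t *\<^sub>C v))"
    by (rule nonneg)
  also have "\<dots> = Re (B u u) - 2 * t * Re (B u v) + t\<^sup>2 * Re (B v v)"
    using Re_commute[of u v] by (simp add: sesquilinear power2_eq_square algebra_simps)
  finally show ?thesis
    using assms by (simp add: field_simps power2_eq_square)
qed

lemma Re_le_twice_add_diff: "Re (B u u) \<le> 2 * Re (B v v) + 2 * Re (B (v - u) (v - u))"
proof -
  have "0 \<le> Re (B (2 *\<^sub>C v - u) (2 *\<^sub>C v - u))"
    by (rule nonneg)
  then show ?thesis
    using Re_commute[of u v] by (simp add: sesquilinear)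
qed

end

lemma psd_form_add:
  assumes "psd_form A" "psd_form B"
  shows "psd_form (\<lambda>u v. A u v + B u v)"
proof -
  interpret A: psd_form A by fact
  interpret B: psd_form B by fact
  show ?thesis
    by unfold_locales (auto simp: A.sesquilinear B.sesquilinear A.cnj_commute B.cnj_commute
        A.nonneg B.nonneg algebra_simps)
qed

lemma psd_form_scale:
  assumes "psd_form A" "c \<ge> 0"
  shows "psd_form (\<lambda>u v. complex_of_real c * A u v)"
proof -
  interpret A: psd_form A by fact
  show ?thesis
    by unfold_locales (auto simp: A.sesquilinear A.cnj_commute A.nonneg assms algebra_simps)
qed

lemma psd_form_sum:
  assumes "\<And>k. k \<in> K \<Longrightarrow> psd_form (A k)"
  shows "psd_form (\<lambda>u v. \<Sum>k\<in>K. A k u v)"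
  using assms
proof (induction K rule: infinite_finite_induct)
  case (insert k K)
  then show ?case
    using psd_form_add[of "A k" "\<lambda>u v. \<Sum>k\<in>K. A k u v"] by simp
qed (unfold_locales; simp)+

lemma psd_form_diff:
  assumes "psd_form A" "psd_form B" "\<And>v. Re (B v v) \<le> Re (A v v)"
  shows "psd_form (\<lambda>u v. A u v - B u v)"
proof -
  interpret A: psd_form A by fact
  interpret B: psd_form B by fact
  show ?thesis
    by unfold_locales
      (use assms(3) in \<open>auto simp: A.sesquilinear B.sesquilinear A.cnj_commute B.cnj_commute
        algebra_simps\<close>)
qed

lemma psd_form_comp:
  assumes "psd_form A" "clinear F"
  shows "psd_form (\<lambda>u v. A (F u) (F v))"
proof -
  interpret A: psd_form A by fact
  show ?thesis
    by unfold_locales (simp_all add: A.sesquilinear A.cnj_commute A.nonneg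
        scaleC.linear_add[OF assms(2)] scaleC.linear_scale[OF assms(2)])
qed

text \<open>If \<^term>\<open>B e e = 0\<close>, then \<^term>\<open>B u e = 0\<close> as well, and the convention \<open>x / 0 = 0\<close> makes the
  Schur complement equal to \<^term>\<open>B\<close>.\<close>

definition schur_complement ::
    "('i cvec \<Rightarrow> 'i cvec \<Rightarrow> complex) \<Rightarrow> 'i cvec \<Rightarrow>
     'i cvec \<Rightarrow> 'i cvec \<Rightarrow> complex" where
  "schur_complement B e u v = B u v - B u e * B e v / B e e"

context psd_form
begin

definition residual :: "'i cvec \<Rightarrow> 'i cvec \<Rightarrow> 'i cvec" where
  "residual e v = v - (B e v / B e e) *\<^sub>C e"

lemma residual_orthogonal: "B e (residual e v) = 0" "B (residual e v) e = 0"
proof -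
  show *: "B e (residual e v) = 0"
    using isotropic_left[of e v] by (cases "B e e = 0") (simp_all add: residual_def sesquilinear)
  show "B (residual e v) e = 0"
    using * by (metis cnj_commute complex_cnj_zero)
qed

lemma schur_complement_eq_residual: "schur_complement B e u v = B (residual e u) (residual e v)"
proof -
  have "B (residual e u) (residual e v) = B u (residual e v)"
    using residual_orthogonal(1)[of e v] by (subst residual_def) (simp add: sesquilinear)
  then show ?thesis
    by (simp add: schur_complement_def residual_def sesquilinear)
qed

lemma psd_form_schur_complement: "psd_form (schur_complement B e)"
proof -
  have "clinear (residual e)"
    by (rule clinearI)
      (auto simp: residual_def sesquilinear fun_eq_iff algebra_simps add_divide_distrib)
  from psd_form_comp[OF psd_form_axioms this] show ?thesis
    unfolding schur_complement_eq_residual[abs_def] .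
qed

lemma complete_square:
  "Re (B (v + c *\<^sub>C e) (v + c *\<^sub>C e))
    = Re (schur_complement B e v v) + Re (B e e) * (cmod (c + B e v / B e e))\<^sup>2"
proof -
  define d where "d = c + B e v / B e e"
  have "v + c *\<^sub>C e = residual e v + d *\<^sub>C e"
    by (simp add: residual_def d_def fun_eq_iff algebra_simps)
  then have expansion:
    "B (v + c *\<^sub>C e) (v + c *\<^sub>C e) = schur_complement B e v v + (d * cnj d) * B e e"
    by (simp add: sesquilinear residual_orthogonal schur_complement_eq_residual)
  have diagonal: "(d * cnj d) * B e e = of_real (Re (B e e) * (cmod d)\<^sup>2)"
    by (subst diag_real) (simp only: of_real_mult complex_norm_square mult.commute)
  show ?thesis
    unfolding expansion diagonal by (simp add: d_def)
qed

lemma schur_complement_le: "Re (schur_complement B e v v) \<le> Re (B (v + c *\<^sub>C e) (v + c *\<^sub>C e))"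
  by (simp add: complete_square nonneg)

lemma schur_complement_attained:
  "\<exists>c. Re (schur_complement B e v v) = Re (B (v + c *\<^sub>C e) (v + c *\<^sub>C e))"
  by (rule exI[of _ "- (B e v / B e e)"]) (subst complete_square, simp)

lemma cauchy_schwarz: "(cmod (B u v))\<^sup>2 \<le> Re (B u u) * Re (B v v)"
proof (cases "Re (B u u) = 0")
  case True
  then show ?thesis by (simp add: isotropic_left)
next
  case False
  then have "Re (B u u) > 0"
    using nonneg[of u] by simp
  have "schur_complement B u v v = B v v - of_real ((cmod (B u v))\<^sup>2 / Re (B u u))"
    using diag_real[of u] mult_cnj_commute[of u v] by (simp add: schur_complement_def mult.commute)
  then have "0 \<le> Re (B v v) - (cmod (B u v))\<^sup>2 / Re (B u u)"
    using psd_form.nonneg[OF psd_form_schur_complement, of u v] by simp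
  then show ?thesis
    using \<open>Re (B u u) > 0\<close> by (simp add: field_simps)
qed

end

lemma psd_form_minimize_coordinates:
  assumes "finite J" "psd_form B"
  shows "\<exists>B'. psd_form B' \<and>
    (\<forall>v w. (\<forall>i. i \<notin> J \<longrightarrow> w i = 0) \<longrightarrow> Re (B' v v) \<le> Re (B (v + w) (v + w))) \<and>
    (\<forall>v. \<exists>w. (\<forall>i. i \<notin> J \<longrightarrow> w i = 0) \<and> Re (B' v v) = Re (B (v + w) (v + w)))"
  using assms(1)
proof (induction J rule: finite_induct)
  case empty
  have "w = 0 \<longleftrightarrow> (\<forall>i. w i = 0)" for w :: "'a \<Rightarrow> complex"
    by (auto simp: fun_eq_iff)
  then show ?case
    using assms(2) by (metis (no_types, lifting) add.right_neutral empty_iff order_refl)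
next
  case (insert j J)
  then obtain B' where "psd_form B'"
    and le: "\<And>v w. \<forall>i. i \<notin> J \<longrightarrow> w i = 0 \<Longrightarrow> Re (B' v v) \<le> Re (B (v + w) (v + w))"
    and attained: "\<And>v. \<exists>w. (\<forall>i. i \<notin> J \<longrightarrow> w i = 0) \<and> Re (B' v v) = Re (B (v + w) (v + w))"
    by blast
  interpret B': psd_form B' by fact
  define S where "S = schur_complement B' (unit_vec j)"
  show ?case
  proof (intro exI[of _ S] conjI allI impI)
    show "psd_form S"
      unfolding S_def by (rule B'.psd_form_schur_complement)
    fix v w :: "'a \<Rightarrow> complex"
    assume w: "\<forall>i. i \<notin> insert j J \<longrightarrow> w i = 0"
    have "Re (S v v) \<le> Re (B' (v + w j *\<^sub>C unit_vec j) (v + w j *\<^sub>C unit_vec j))"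
      unfolding S_def by (rule B'.schur_complement_le)
    also have "\<dots> \<le> Re (B (v + w j *\<^sub>C unit_vec j + w(j := 0)) (v + w j *\<^sub>C unit_vec j + w(j := 0)))"
      by (rule le) (use w in simp)
    also have "v + w j *\<^sub>C unit_vec j + w(j := 0) = v + w"
      by (auto simp: fun_eq_iff unit_vec_def)
    finally show "Re (S v v) \<le> Re (B (v + w) (v + w))" .
  next
    fix v :: "'a \<Rightarrow> complex"
    obtain c where "Re (S v v) = Re (B' (v + c *\<^sub>C unit_vec j) (v + c *\<^sub>C unit_vec j))"
      unfolding S_def using B'.schur_complement_attained by blast
    moreover obtain w where "\<forall>i. i \<notin> J \<longrightarrow> w i = 0"
      "Re (B' (v + c *\<^sub>C unit_vec j) (v + c *\<^sub>C unit_vec j))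
        = Re (B (v + c *\<^sub>C unit_vec j + w) (v + c *\<^sub>C unit_vec j + w))"
      using attained by blast
    ultimately show "\<exists>w. (\<forall>i. i \<notin> insert j J \<longrightarrow> w i = 0) \<and> Re (S v v) = Re (B (v + w) (v + w))"
      by (intro exI[of _ "c *\<^sub>C unit_vec j + w"]) (simp add: unit_vec_def add.assoc)
  qed
qed

lemma psd_form_inf_convolution:
  fixes s :: "'j::finite cvec \<Rightarrow> 'i \<Rightarrow> complex"
  assumes "psd_form B" "psd_form \<kappa>" "clinear s"
  obtains B' where "psd_form B'"
    "\<And>z w. Re (B' z z) \<le> Re (B (z - s w) (z - s w)) + Re (\<kappa> w w)"
    "\<And>z. \<exists>w. Re (B' z z) = Re (B (z - s w) (z - s w)) + Re (\<kappa> w w)"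
proof -
  define left where "left = (\<lambda>(f :: 'i + 'j \<Rightarrow> complex) i. f (Inl i))"
  define right where "right = (\<lambda>(f :: 'i + 'j \<Rightarrow> complex) j. f (Inr j))"
  define join :: "'i cvec \<Rightarrow> 'j cvec \<Rightarrow> 'i + 'j \<Rightarrow> complex" where "join = case_sum"
  have clinear_left: "clinear left" and clinear_right: "clinear right"
    by (auto intro!: clinearI simp: left_def right_def fun_eq_iff)
  have clinear_embed: "clinear (\<lambda>z. join z 0)"
    by (auto intro!: clinearI simp: join_def fun_eq_iff split: sum.split)
  have join_simps: "left (join z w) = z" "right (join z w) = w"
    "join z 0 + join 0 w = join z w" for z w
    by (auto simp: left_def right_def join_def fun_eq_iff split: sum.split)
  have supported: "(\<forall>k. k \<notin> range Inr \<longrightarrow> w k = 0) \<longleftrightarrow> w = join 0 (right w)" for w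
    by (auto simp: join_def right_def fun_eq_iff image_iff split: sum.split) (metis sum.exhaust)
  define F where
    "F = (\<lambda>f g. B (left f - s (right f)) (left g - s (right g)) + \<kappa> (right f) (right g))"
  have F_join: "F (join z w) (join z w) = B (z - s w) (z - s w) + \<kappa> w w" for z w
    by (simp add: F_def join_simps)
  have "psd_form F"
    unfolding F_def
    by (intro psd_form_add psd_form_comp[OF assms(1)] psd_form_comp[OF assms(2)]
        scaleC.linear_compose_sub clinear_comp[OF assms(3)] clinear_left clinear_right)
  with psd_form_minimize_coordinates[of "range Inr" F]
  obtain F' where "psd_form F'"
    and le: "\<And>v w. w = join 0 (right w) \<Longrightarrow> Re (F' v v) \<le> Re (F (v + w) (v + w))"
    and attained: "\<And>v. \<exists>w. w = join 0 (right w) \<and> Re (F' v v) = Re (F (v + w) (v + w))"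
    unfolding supported by auto
  show ?thesis
  proof (rule that)
    show "psd_form (\<lambda>u v. F' (join u 0) (join v 0))"
      by (rule psd_form_comp[OF \<open>psd_form F'\<close> clinear_embed])
    show "Re (F' (join z 0) (join z 0)) \<le> Re (B (z - s w) (z - s w)) + Re (\<kappa> w w)" for z w
      using le[of "join 0 w" "join z 0"] by (simp add: join_simps F_join)
    show "\<exists>w. Re (F' (join z 0) (join z 0)) = Re (B (z - s w) (z - s w)) + Re (\<kappa> w w)" for z
      using attained[of "join z 0"] by (metis F_join join_simps(3) plus_complex.sel(1))
  qed
qed

section \<open>Effects and sequential decoding\<close>

definition cinner :: "'i set \<Rightarrow> 'i cvec \<Rightarrow> 'i cvec \<Rightarrow> complex" where
  "cinner S u v = (\<Sum>i\<in>S. cnj (u i) * v i)"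

abbreviation sqnorm :: "'i set \<Rightarrow> 'i cvec \<Rightarrow> real" where
  "sqnorm S v \<equiv> Re (cinner S v v)"

abbreviation accept :: "'i set \<Rightarrow> ('i cvec \<Rightarrow> 'i cvec) \<Rightarrow> 'i cvec \<Rightarrow> real" where
  "accept S F v \<equiv> Re (cinner S v (F v))"

abbreviation reject :: "'i set \<Rightarrow> ('i cvec \<Rightarrow> 'i cvec) \<Rightarrow> 'i cvec \<Rightarrow> real" where
  "reject S F v \<equiv> sqnorm S v - accept S F v"

lemma psd_form_cinner: "psd_form (cinner S)"
proof
  show "0 \<le> sqnorm S v" for v
    unfolding cinner_def Re_sum by (rule sum_nonneg) simp
qed (simp_all add: cinner_def sum.distrib algebra_simps sum_distrib_left)

interpretation cinner: psd_form "cinner S" for S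
  by (rule psd_form_cinner)

lemma sqnorm_mono: "finite S' \<Longrightarrow> S \<subseteq> S' \<Longrightarrow> sqnorm S v \<le> sqnorm S' v"
  unfolding cinner_def Re_sum by (rule sum_mono2) auto

lemma cinner_cong:
  "(\<And>i. i \<in> S \<Longrightarrow> u i = u' i) \<Longrightarrow> (\<And>i. i \<in> S \<Longrightarrow> v i = v' i) \<Longrightarrow> cinner S u v = cinner S u' v'"
  by (simp add: cinner_def)

definition effect :: "'i set \<Rightarrow> ('i cvec \<Rightarrow> 'i cvec) \<Rightarrow> bool" where
  "effect S F \<longleftrightarrow> clinear F \<and> psd_form (\<lambda>u v. cinner S u (F v)) \<and> (\<forall>v. accept S F v \<le> sqnorm S v)"

lemma effect_clinear: "effect S F \<Longrightarrow> clinear F"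
  and effect_psd_form: "effect S F \<Longrightarrow> psd_form (\<lambda>u v. cinner S u (F v))"
  and accept_le_sqnorm: "effect S F \<Longrightarrow> accept S F v \<le> sqnorm S v"
  by (auto simp: effect_def)

lemma effect_selfadjoint: "effect S F \<Longrightarrow> cinner S (F u) v = cinner S u (F v)"
  using psd_form.cnj_commute[OF effect_psd_form, of S F v u] cinner.cnj_commute[of S v "F u"]
  by simp

lemma accept_nonneg: "effect S F \<Longrightarrow> 0 \<le> accept S F v"
  by (rule psd_form.nonneg[OF effect_psd_form])

lemma sqnorm_effect_le_accept:
  assumes "effect S F"
  shows "sqnorm S (F v) \<le> accept S F v"
proof -
  have "cinner S v (F (F v)) = of_real (sqnorm S (F v))"
    using effect_selfadjoint[OF assms, of v "F v"] cinner.diag_real[of S "F v"] by simp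
  then have "(sqnorm S (F v))\<^sup>2 = (cmod (cinner S v (F (F v))))\<^sup>2"
    by simp
  also have "\<dots> \<le> accept S F v * accept S F (F v)"
    by (rule psd_form.cauchy_schwarz[OF effect_psd_form[OF assms]])
  also have "\<dots> \<le> accept S F v * sqnorm S (F v)"
    by (rule mult_left_mono[OF accept_le_sqnorm[OF assms] accept_nonneg[OF assms]])
  finally have "sqnorm S (F v) * sqnorm S (F v) \<le> accept S F v * sqnorm S (F v)"
    by (simp add: power2_eq_square)
  then show ?thesis
    using cinner.nonneg[of S "F v"] accept_nonneg[OF assms, of v]
    by (metis less_eq_real_def mult_right_le_imp_le)
qed

lemma effect_compl:
  assumes "effect S F"
  shows "effect S (\<lambda>v. v - F v)"
  unfolding effect_def
proof (intro conjI allI)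
  show "clinear (\<lambda>v. v - F v)"
    by (rule clinear_compl[OF effect_clinear[OF assms]])
  show "psd_form (\<lambda>u v. cinner S u (v - F v))"
    unfolding cinner.diff_right
    by (rule psd_form_diff[OF psd_form_cinner effect_psd_form[OF assms] accept_le_sqnorm[OF assms]])
  show "Re (cinner S v (v - F v)) \<le> sqnorm S v" for v
    using accept_nonneg[OF assms] by (simp add: cinner.diff_right)
qed

lemma sqnorm_residual_eq:
  assumes "effect S F"
  shows "sqnorm S (v - F v) = sqnorm S v - 2 * accept S F v + sqnorm S (F v)"
  by (simp add: cinner.sesquilinear effect_selfadjoint[OF assms])

lemma effect_of_psd_form:
  assumes "psd_form B" "finite S" and le: "\<And>v. Re (B v v) \<le> sqnorm S v"
  obtains F where "effect S F" "\<And>u v. cinner S u (F v) = B u v"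
proof -
  interpret B: psd_form B by fact
  define F where "F = (\<lambda>v i. B (unit_vec i) v)"
  have cinner_F: "cinner S u (F v) = B u v" for u v
  proof -
    define u' where "u' = (\<Sum>i\<in>S. u i *\<^sub>C unit_vec i)"
    have "u' i = (if i \<in> S then u i else 0)" for i
      using \<open>finite S\<close>
      by (simp add: u'_def sum_fun_apply unit_vec_def if_distrib[of "\<lambda>x. _ * x"]
          cong: if_cong)
    then have "sqnorm S (u - u') = 0"
      by (simp add: cinner_def)
    then have "B (u - u') v = 0"
      using le[of "u - u'"] B.nonneg[of "u - u'"] by (intro B.isotropic_left) simp
    then have "B u v = B u' v"
      by (simp add: B.diff_left)
    also have "\<dots> = cinner S u (F v)"
      by (simp add: u'_def B.sum_left B.scale_left cinner_def F_def)
    finally show ?thesis by simp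
  qed
  have "clinear F"
    by (rule clinearI) (auto simp: F_def fun_eq_iff B.sesquilinear)
  then have "effect S F"
    using assms(1) le by (simp add: effect_def cinner_F)
  then show ?thesis
    using that cinner_F by blast
qed

definition survive :: "('i cvec \<Rightarrow> 'i cvec) list \<Rightarrow> 'i cvec \<Rightarrow> 'i cvec" where
  "survive Qs = fold (\<lambda>Q v. v - Q v) Qs"

lemma survive_simps [simp]:
  "survive [] v = v"
  "survive (Q # Qs) v = survive Qs (v - Q v)"
  by (simp_all add: survive_def)

lemma survive_snoc: "survive (Qs @ [Q]) v = survive Qs v - Q (survive Qs v)"
  by (simp add: survive_def)

lemma clinear_survive:
  assumes "\<And>Q. Q \<in> set Qs \<Longrightarrow> clinear Q"
  shows "clinear (survive Qs)"
  using assms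
proof (induction Qs)
  case Nil
  then show ?case by (intro clinearI) (simp_all only: survive_simps)
next
  case (Cons Q Qs)
  have "clinear (\<lambda>v. survive Qs (v - Q v))"
    by (rule clinear_comp[OF Cons.IH clinear_compl]; rule Cons.prems; simp)
  moreover have "survive (Q # Qs) = (\<lambda>v. survive Qs (v - Q v))"
    by (rule ext) (rule survive_simps(2))
  ultimately show ?case by (simp only:)
qed

lemma cinner_survive_ge:
  assumes "\<And>Q. Q \<in> set Qs \<Longrightarrow> effect S Q"
  shows "4 * (sqnorm S v - Re (cinner S v (survive Qs v)))
    \<le> 4 * (\<Sum>Q\<leftarrow>Qs. accept S Q v) + (sqnorm S v - sqnorm S (survive Qs v))"
  using assms
proof (induction Qs rule: rev_induct)
  case Nil
  then show ?case by simp
next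
  case (snoc Q Qs)
  define u u' where "u = survive Qs v" and "u' = u - Q u"
  have "survive (Qs @ [Q]) v = u'"
    by (simp only: survive_snoc u_def u'_def)
  have "effect S Q"
    using snoc.prems by simp
  have "2 * Re (cinner S v (Q u)) \<le> (1/2) * accept S Q u + accept S Q v / (1/2)"
    by (rule psd_form.two_Re_le_weighted[OF effect_psd_form[OF \<open>effect S Q\<close>]]) simp
  moreover have "sqnorm S u' \<le> sqnorm S u - accept S Q u"
    using sqnorm_residual_eq[OF \<open>effect S Q\<close>, of u] sqnorm_effect_le_accept[OF \<open>effect S Q\<close>, of u]
    unfolding u'_def by simp
  moreover have "4 * (sqnorm S v - Re (cinner S v u))
      \<le> 4 * (\<Sum>Q\<leftarrow>Qs. accept S Q v) + (sqnorm S v - sqnorm S u)"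
    using snoc by (simp add: u_def)
  moreover have "Re (cinner S v u') = Re (cinner S v u) - Re (cinner S v (Q u))"
    by (simp only: u'_def cinner.diff_right minus_complex.sel)
  moreover have "(\<Sum>P\<leftarrow>Qs @ [Q]. accept S P v) = (\<Sum>P\<leftarrow>Qs. accept S P v) + accept S Q v"
    by simp
  ultimately show ?case
    unfolding \<open>survive (Qs @ [Q]) v = u'\<close> by argo
qed

text \<open>The non-commutative union bound, with factor 4 in place of the factor 1 of commuting tests.\<close>

lemma union_bound:
  assumes "\<And>Q. Q \<in> set Qs \<Longrightarrow> effect S Q"
  shows "sqnorm S v - sqnorm S (survive Qs v) \<le> 4 * (\<Sum>Q\<leftarrow>Qs. accept S Q v)"
proof -
  have "2 * Re (cinner S v (survive Qs v)) \<le> sqnorm S v + sqnorm S (survive Qs v)"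
    using cinner.two_Re_le_weighted[of 1 S v "survive Qs v"] by simp
  moreover have "4 * (sqnorm S v - Re (cinner S v (survive Qs v)))
      \<le> 4 * (\<Sum>Q\<leftarrow>Qs. accept S Q v) + (sqnorm S v - sqnorm S (survive Qs v))"
    by (rule cinner_survive_ge) (fact assms)
  ultimately show ?thesis
    by argo
qed

definition detect :: "('k \<Rightarrow> 'i cvec \<Rightarrow> 'i cvec) \<Rightarrow> 'k list \<Rightarrow> 'k \<Rightarrow> 'i cvec \<Rightarrow> 'i cvec" where
  "detect E ks k v = E k (survive (map E (takeWhile (\<lambda>j. j \<noteq> k) ks)) v)"

lemma clinear_detect:
  assumes "\<And>j. j \<in> set ks \<Longrightarrow> clinear (E j)" "k \<in> set ks"
  shows "clinear (detect E ks k)"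
proof -
  have "clinear (\<lambda>v. E k (survive (map E (takeWhile (\<lambda>j. j \<noteq> k) ks)) v))"
    by (rule clinear_comp[OF assms(1)[OF assms(2)] clinear_survive])
      (use assms(1) in \<open>auto dest: set_takeWhileD\<close>)
  then show ?thesis
    by (simp add: detect_def[abs_def])
qed

lemma sum_sqnorm_detect_le:
  assumes "distinct ks" "\<And>k. k \<in> set ks \<Longrightarrow> effect S (E k)"
  shows "(\<Sum>k\<in>set ks. sqnorm S (detect E ks k v)) \<le> sqnorm S v"
  using assms
proof (induction ks arbitrary: v)
  case Nil
  then show ?case by (simp add: cinner.nonneg)
next
  case (Cons a ks)
  have "effect S (E a)"
    using Cons.prems by simp
  have "(\<Sum>k\<in>set ks. sqnorm S (detect E (a # ks) k v))
      = (\<Sum>k\<in>set ks. sqnorm S (detect E ks k (v - E a v)))"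
    using Cons.prems(1) by (intro sum.cong refl) (auto simp: detect_def)
  also have "\<dots> \<le> sqnorm S (v - E a v)"
    using Cons.prems by (intro Cons.IH) auto
  finally have "(\<Sum>k\<in>set (a # ks). sqnorm S (detect E (a # ks) k v))
      \<le> sqnorm S (E a v) + sqnorm S (v - E a v)"
    using Cons.prems(1) by (simp add: detect_def)
  also have "\<dots> \<le> sqnorm S v"
    using sqnorm_effect_le_accept[OF \<open>effect S (E a)\<close>, of v]
    by (simp add: sqnorm_residual_eq[OF \<open>effect S (E a)\<close>])
  finally show ?case .
qed

lemma sqnorm_diff_detect_le:
  assumes "distinct ks" "\<And>j. j \<in> set ks \<Longrightarrow> effect S (E j)" "k \<in> set ks"
  shows "sqnorm S v - sqnorm S (detect E ks k v)
    \<le> 4 * (reject S (E k) v + (\<Sum>j\<in>set ks - {k}. accept S (E j) v))"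
proof -
  define js where "js = takeWhile (\<lambda>j. j \<noteq> k) ks"
  have js: "distinct js" "set js \<subseteq> set ks - {k}"
    using assms(1) by (auto simp: js_def dest: set_takeWhileD)
  define Qs where "Qs = map E js @ [\<lambda>v. v - E k v]"
  have "sqnorm S v - sqnorm S (survive Qs v) \<le> 4 * (\<Sum>Q\<leftarrow>Qs. accept S Q v)"
    by (rule union_bound) (use js(2) assms(2,3) in \<open>auto simp: Qs_def intro: effect_compl\<close>)
  also have "survive Qs v = detect E ks k v"
    by (simp add: Qs_def detect_def js_def survive_snoc)
  also have "(\<Sum>Q\<leftarrow>Qs. accept S Q v) = reject S (E k) v + (\<Sum>j\<in>set js. accept S (E j) v)"
    using js(1) by (simp add: Qs_def cinner.diff_right sum_list_distinct_conv_sum_set comp_def)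
  also have "(\<Sum>j\<in>set js. accept S (E j) v) \<le> (\<Sum>j\<in>set ks - {k}. accept S (E j) v)"
    by (rule sum_mono2) (use js(2) assms(2) in \<open>auto intro: accept_nonneg\<close>)
  finally show ?thesis by simp
qed

lemma sequential_decoder:
  fixes E :: "'k \<Rightarrow> 'i cvec \<Rightarrow> 'i cvec"
  assumes "finite I" "I \<noteq> {}" and effect: "\<And>k. k \<in> I \<Longrightarrow> effect S (E k)"
  obtains L where "\<And>k. k \<in> I \<Longrightarrow> psd_form (L k)"
    "\<And>u v. (\<Sum>k\<in>I. L k u v) = cinner S u v"
    "\<And>k v. k \<in> I \<Longrightarrow> sqnorm S v - Re (L k v v)
       \<le> 4 * (reject S (E k) v + (\<Sum>j\<in>I - {k}. accept S (E j) v))"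
proof -
  obtain ks where ks: "set ks = I" "distinct ks"
    using finite_distinct_list[OF assms(1)] by blast
  obtain k\<^sub>0 where "k\<^sub>0 \<in> I"
    using assms(2) by blast
  define N where "N = (\<lambda>k u v. cinner S (detect E ks k u) (detect E ks k v))"
  have N: "psd_form (N k)" if "k \<in> I" for k
    unfolding N_def using that ks(1) effect effect_clinear
    by (intro psd_form_comp[OF psd_form_cinner clinear_detect]) auto
  define D where "D = (\<lambda>u v. cinner S u v - (\<Sum>k\<in>I. N k u v))"
  have D: "psd_form D"
    unfolding D_def
  proof (rule psd_form_diff[OF psd_form_cinner psd_form_sum[OF N]])
    show "Re (\<Sum>k\<in>I. N k v v) \<le> sqnorm S v" for v
      using sum_sqnorm_detect_le[OF ks(2), of S E v] ks(1) effect by (simp add: N_def)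
  qed
  define L where "L = (\<lambda>k u v. N k u v + (if k = k\<^sub>0 then D u v else 0))"
  show ?thesis
  proof
    show "psd_form (L k)" if "k \<in> I" for k
      using psd_form_add[OF N[OF that] D] N[OF that] by (cases "k = k\<^sub>0") (simp_all add: L_def)
    show "(\<Sum>k\<in>I. L k u v) = cinner S u v" for u v
      using \<open>finite I\<close> \<open>k\<^sub>0 \<in> I\<close> by (simp add: L_def sum.distrib D_def)
    fix k v
    assume "k \<in> I"
    have "sqnorm S v - Re (L k v v) \<le> sqnorm S v - Re (N k v v)"
      using psd_form.nonneg[OF D, of v] by (simp add: L_def)
    also have "\<dots> \<le> 4 * (reject S (E k) v + (\<Sum>j\<in>I - {k}. accept S (E j) v))"
      using sqnorm_diff_detect_le[OF ks(2), of S E k v] \<open>k \<in> I\<close> ks(1) effect by (simp add: N_def)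
    finally show "sqnorm S v - Re (L k v v)
       \<le> 4 * (reject S (E k) v + (\<Sum>j\<in>I - {k}. accept S (E j) v))" .
  qed
qed

section \<open>A joint test for well-conditioned directions\<close>

definition tensor_vec :: "'i cvec \<Rightarrow> 'd cvec \<Rightarrow> ('i \<times> 'd) cvec" (infixr "\<otimes>" 72) where
  "v \<otimes> c = (\<lambda>(i, d). v i * c d)"

lemma tensor_vec_apply [simp]: "(v \<otimes> c) (i, d) = v i * c d"
  by (simp add: tensor_vec_def)

lemma tensor_vec_diff_right: "v \<otimes> (b - c) = v \<otimes> b - v \<otimes> c"
  by (auto simp: fun_eq_iff algebra_simps)

lemma clinear_tensor_vec: "clinear (\<lambda>v. v \<otimes> c)"
  by (rule clinearI) (auto simp: fun_eq_iff algebra_simps)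

lemma cinner_tensor_vec: "cinner (A \<times> D) (u \<otimes> b) (v \<otimes> c) = cinner A u v * cinner D b c"
  by (simp add: cinner_def sum_product sum.cartesian_product mult_ac split_def tensor_vec_def)

lemma sqnorm_tensor_vec: "sqnorm (A \<times> D) (v \<otimes> c) = sqnorm A v * sqnorm D c"
  by (simp add: cinner_tensor_vec cinner.Im_diag)

lemma sqnorm_eq_sum_cmod: "sqnorm S v = (\<Sum>i\<in>S. (cmod (v i))\<^sup>2)"
  by (simp add: cinner_def cmod_power2 flip: power2_eq_square)

lemma sqnorm_sum_tensor_vec_ge:
  fixes x :: "'k::finite \<Rightarrow> 'i cvec"
  assumes "\<And>t. \<mu> * (\<Sum>i\<in>UNIV. (cmod (t i))\<^sup>2) \<le> sqnorm D (\<Sum>i\<in>UNIV. t i *\<^sub>C f i)"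
  shows "\<mu> * (\<Sum>i\<in>UNIV. sqnorm S (x i)) \<le> sqnorm (S \<times> D) (\<Sum>i\<in>UNIV. x i \<otimes> f i)"
proof -
  have "\<mu> * (\<Sum>i\<in>UNIV. sqnorm S (x i)) = (\<Sum>z\<in>S. \<mu> * (\<Sum>i\<in>UNIV. (cmod (x i z))\<^sup>2))"
    unfolding sqnorm_eq_sum_cmod by (subst sum.swap) (rule sum_distrib_left)
  also have "\<dots> \<le> (\<Sum>z\<in>S. sqnorm D (\<Sum>i\<in>UNIV. x i z *\<^sub>C f i))"
    by (intro sum_mono assms)
  also have "\<dots> = sqnorm (S \<times> D) (\<Sum>i\<in>UNIV. x i \<otimes> f i)"
    by (simp add: sqnorm_eq_sum_cmod sum.cartesian_product' sum_fun_apply)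
  finally show ?thesis .
qed

lemma psd_form_defect:
  assumes "effect S T"
  shows "psd_form (\<lambda>u v. cinner S u (T v) - cinner S (T u) (T v))"
  by (rule psd_form_diff[OF effect_psd_form[OF assms]
        psd_form_comp[OF psd_form_cinner effect_clinear[OF assms]]
        sqnorm_effect_le_accept[OF assms]])

lemma two_Re_residual_le:
  assumes "effect S T" "\<mu> > 0"
  shows "2 * Re (b * cinner S v (w - T w))
    \<le> \<mu> * (sqnorm S (w - T w) + (accept S T w - sqnorm S (T w))) + (cmod b)\<^sup>2 / \<mu> * reject S T v"
proof -
  interpret compl: psd_form "\<lambda>u v. cinner S u (v - T v)"
    by (rule effect_psd_form[OF effect_compl[OF assms(1)]])
  have "2 * Re (cinner S (cnj b *\<^sub>C v) (w - T w))
      \<le> \<mu> * Re (cinner S w (w - T w))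
        + Re (cinner S (cnj b *\<^sub>C v) (cnj b *\<^sub>C v - T (cnj b *\<^sub>C v))) / \<mu>"
    by (rule compl.two_Re_le_weighted[OF assms(2)])
  moreover have "cinner S (cnj b *\<^sub>C v) (w - T w) = b * cinner S v (w - T w)"
    by (simp add: cinner.scale_left)
  moreover have "Re (cinner S w (w - T w)) = sqnorm S (w - T w) + (accept S T w - sqnorm S (T w))"
    unfolding sqnorm_residual_eq[OF assms(1)] by (simp add: cinner.diff_right)
  moreover have "Re (cinner S (cnj b *\<^sub>C v) (cnj b *\<^sub>C v - T (cnj b *\<^sub>C v)))
      = (cmod b)\<^sup>2 * reject S T v"
  proof -
    have "cinner S (cnj b *\<^sub>C v) (cnj b *\<^sub>C v - T (cnj b *\<^sub>C v))
        = of_real ((cmod b)\<^sup>2) * cinner S v (v - T v)"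
      by (simp only: compl.scale_left compl.scale_right complex_norm_square complex_cnj_cnj mult_ac)
    then show ?thesis
      by (simp add: cinner.diff_right flip: of_real_power)
  qed
  ultimately show ?thesis
    by (simp only: times_divide_eq_left)
qed

text \<open>The test is the infimal convolution of the squared norm with the rejection forms of the tests
  \<^term>\<open>T i\<close>, tilted in the directions \<^term>\<open>f i\<close>.  For projective tests it is the projection onto
  the orthogonal complement of the sum of the tilted rejection subspaces; in general the defects
  \<open>T - T\<^sup>2\<close> enter as a penalty.\<close>

definition block :: "('k \<times> 'i) cvec \<Rightarrow> 'k \<Rightarrow> 'i cvec" where
  "block w k = (\<lambda>i. w (k, i))"

definition tilted_rejection ::
    "('k::finite \<Rightarrow> 'i cvec \<Rightarrow> 'i cvec) \<Rightarrow> ('k \<Rightarrow> 'd cvec) \<Rightarrow> ('k \<times> 'i) cvec \<Rightarrow> ('i \<times> 'd) cvec" where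
  "tilted_rejection T f w = (\<Sum>k\<in>UNIV. (block w k - T k (block w k)) \<otimes> f k)"

definition defect_penalty ::
    "'d set \<Rightarrow> ('k::finite \<Rightarrow> ('i::finite) cvec \<Rightarrow> 'i cvec) \<Rightarrow> ('k \<Rightarrow> 'd cvec) \<Rightarrow>
     ('k \<times> 'i) cvec \<Rightarrow> ('k \<times> 'i) cvec \<Rightarrow> complex" where
  "defect_penalty D T f u v = (\<Sum>k\<in>UNIV. complex_of_real (sqnorm D (f k)) *
     (cinner UNIV (block u k) (T k (block v k)) - cinner UNIV (T k (block u k)) (T k (block v k))))"

lemma clinear_block: "clinear (\<lambda>w. block w k)"
  by (rule clinearI) (auto simp: block_def fun_eq_iff)

lemma clinear_tilted_rejection:
  assumes "\<And>k. effect UNIV (T k)"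
  shows "clinear (tilted_rejection T f)"
  unfolding tilted_rejection_def[abs_def]
  by (intro scaleC.linear_compose_sum ballI
      clinear_comp[OF _ clinear_block] clinear_comp[OF clinear_tensor_vec]
      clinear_compl[OF effect_clinear[OF assms]])

lemma psd_form_defect_penalty:
  assumes "\<And>k. effect UNIV (T k)"
  shows "psd_form (defect_penalty D T f)"
  unfolding defect_penalty_def[abs_def]
  by (intro psd_form_sum psd_form_scale cinner.nonneg
      psd_form_comp[OF psd_form_defect[OF assms] clinear_block])

lemma Re_defect_penalty:
  "Re (defect_penalty D T f w w) = (\<Sum>k\<in>UNIV. sqnorm D (f k) *
     (accept UNIV (T k) (block w k) - sqnorm UNIV (T k (block w k))))"
  by (simp add: defect_penalty_def)

lemma tilted_rejection_sound:
  fixes T :: "'k::finite \<Rightarrow> ('i::finite) cvec \<Rightarrow> 'i cvec"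
  assumes effect: "\<And>k. effect UNIV (T k)" and c: "\<And>d. d \<in> D \<Longrightarrow> c d = f k d"
  shows "\<exists>w. sqnorm (UNIV \<times> D) (v \<otimes> c - tilted_rejection T f w) + Re (defect_penalty D T f w w)
    = sqnorm D (f k) * accept UNIV (T k) v"
proof -
  define w where "w = (\<lambda>(j, i). if j = k then v i else 0)"
  have block: "block w j = (if j = k then v else 0)" for j
    by (auto simp: w_def block_def)
  have zero: "T j 0 = 0" for j
    by (rule scaleC.linear_0[OF effect_clinear[OF effect]])
  have "tilted_rejection T f w = (\<Sum>j\<in>UNIV. if j = k then (v - T k v) \<otimes> f k else 0)"
    unfolding tilted_rejection_def block
    by (intro sum.cong refl) (auto simp: zero fun_eq_iff)
  then have "tilted_rejection T f w = (v - T k v) \<otimes> f k"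
    by simp
  then have "sqnorm (UNIV \<times> D) (v \<otimes> c - tilted_rejection T f w) = sqnorm (UNIV \<times> D) (T k v \<otimes> f k)"
    by (intro arg_cong[of _ _ Re] cinner_cong) (auto simp: c algebra_simps)
  also have "\<dots> = sqnorm UNIV (T k v) * sqnorm D (f k)"
    by (rule sqnorm_tensor_vec)
  moreover have "Re (defect_penalty D T f w w) = (\<Sum>j\<in>UNIV. if j = k then
      sqnorm D (f k) * (accept UNIV (T k) v - sqnorm UNIV (T k v)) else 0)"
    unfolding Re_defect_penalty block
    by (intro sum.cong refl) (auto simp: zero cinner.zero_left)
  ultimately show ?thesis
    by (intro exI[of _ w]) (simp add: algebra_simps)
qed

lemma tilted_rejection_complete:
  fixes T :: "'k::finite \<Rightarrow> ('i::finite) cvec \<Rightarrow> 'i cvec"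
  assumes effect: "\<And>k. effect UNIV (T k)" and \<mu>: "\<mu> > 0"
    and gram: "\<And>t. \<mu> * (\<Sum>k\<in>UNIV. (cmod (t k))\<^sup>2) \<le> sqnorm D (\<Sum>k\<in>UNIV. t k *\<^sub>C f k)"
  shows "sqnorm UNIV v * sqnorm D c
      - (\<Sum>k\<in>UNIV. (cmod (cinner D c (f k)))\<^sup>2 / \<mu> * reject UNIV (T k) v)
    \<le> sqnorm (UNIV \<times> D) (v \<otimes> c - tilted_rejection T f w) + Re (defect_penalty D T f w w)"
proof -
  define x where "x = (\<lambda>k. block w k - T k (block w k))"
  define \<kappa> where "\<kappa> = (\<lambda>k. accept UNIV (T k) (block w k) - sqnorm UNIV (T k (block w k)))"
  define R where "R = tilted_rejection T f w"
  have R: "R = (\<Sum>k\<in>UNIV. x k \<otimes> f k)"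
    by (simp add: R_def tilted_rejection_def x_def)
  have \<mu>_le: "\<mu> \<le> sqnorm D (f k)" for k
    using gram[of "\<lambda>j. if j = k then 1 else 0"]
    by (simp add: if_distrib[of cmod] if_distrib[of "\<lambda>t. t\<^sup>2"] if_distrib[of "\<lambda>t. t *\<^sub>C _"]
        cong: if_cong)
  have "\<mu> * (\<Sum>k\<in>UNIV. \<kappa> k) \<le> (\<Sum>k\<in>UNIV. sqnorm D (f k) * \<kappa> k)"
    unfolding sum_distrib_left \<kappa>_def
    by (intro sum_mono mult_right_mono \<mu>_le) (simp add: sqnorm_effect_le_accept[OF effect])
  moreover have "\<mu> * (\<Sum>k\<in>UNIV. sqnorm UNIV (x k)) \<le> sqnorm (UNIV \<times> D) R"
    unfolding R by (rule sqnorm_sum_tensor_vec_ge[OF gram])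
  moreover have "2 * Re (cinner (UNIV \<times> D) (v \<otimes> c) R)
      \<le> \<mu> * (\<Sum>k\<in>UNIV. sqnorm UNIV (x k)) + \<mu> * (\<Sum>k\<in>UNIV. \<kappa> k)
        + (\<Sum>k\<in>UNIV. (cmod (cinner D c (f k)))\<^sup>2 / \<mu> * reject UNIV (T k) v)"
  proof -
    have "2 * Re (cinner (UNIV \<times> D) (v \<otimes> c) R)
        = (\<Sum>k\<in>UNIV. 2 * Re (cinner D c (f k) * cinner UNIV v (x k)))"
      by (simp only: R cinner.sum_right cinner_tensor_vec Re_sum sum_distrib_left mult.commute)
    also have "\<dots> \<le> (\<Sum>k\<in>UNIV. \<mu> * (sqnorm UNIV (x k) + \<kappa> k)
        + (cmod (cinner D c (f k)))\<^sup>2 / \<mu> * reject UNIV (T k) v)"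
      unfolding x_def \<kappa>_def by (intro sum_mono two_Re_residual_le effect \<mu>)
    finally show ?thesis
      by (simp add: sum.distrib distrib_left sum_distrib_left)
  qed
  moreover have "sqnorm (UNIV \<times> D) (v \<otimes> c - R) = sqnorm UNIV v * sqnorm D c
      - 2 * Re (cinner (UNIV \<times> D) (v \<otimes> c) R) + sqnorm (UNIV \<times> D) R"
    using cinner.Re_commute[of "UNIV \<times> D" R "v \<otimes> c"]
    by (simp add: cinner.sesquilinear flip: sqnorm_tensor_vec)
  moreover have "Re (defect_penalty D T f w w) = (\<Sum>k\<in>UNIV. sqnorm D (f k) * \<kappa> k)"
    by (simp only: Re_defect_penalty \<kappa>_def)
  ultimately show ?thesis
    unfolding R_def[symmetric] by linarith
qed

lemma joint_test:
  fixes T :: "'k::finite \<Rightarrow> ('i::finite) cvec \<Rightarrow> 'i cvec" and f :: "'k \<Rightarrow> 'd cvec"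
  assumes effect: "\<And>k. effect UNIV (T k)" and \<mu>: "\<mu> > 0"
    and gram: "\<And>t. \<mu> * (\<Sum>k\<in>UNIV. (cmod (t k))\<^sup>2) \<le> sqnorm D (\<Sum>k\<in>UNIV. t k *\<^sub>C f k)"
  obtains P where "psd_form P"
    "\<And>z. Re (P z z) \<le> sqnorm (UNIV \<times> D) z"
    "\<And>v c k. (\<And>d. d \<in> D \<Longrightarrow> c d = f k d) \<Longrightarrow>
       Re (P (v \<otimes> c) (v \<otimes> c)) \<le> sqnorm D (f k) * accept UNIV (T k) v"
    "\<And>v c. sqnorm UNIV v * sqnorm D c - Re (P (v \<otimes> c) (v \<otimes> c))
       \<le> (\<Sum>k\<in>UNIV. (cmod (cinner D c (f k)))\<^sup>2 / \<mu> * reject UNIV (T k) v)"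
proof -
  note penalty = psd_form_defect_penalty[of T D f, OF effect]
  note rejection = clinear_tilted_rejection[of T f, OF effect]
  obtain P where P: "psd_form P"
    and le: "\<And>z w. Re (P z z)
      \<le> sqnorm (UNIV \<times> D) (z - tilted_rejection T f w) + Re (defect_penalty D T f w w)"
    and attained: "\<And>z. \<exists>w. Re (P z z)
      = sqnorm (UNIV \<times> D) (z - tilted_rejection T f w) + Re (defect_penalty D T f w w)"
    using psd_form_inf_convolution[OF psd_form_cinner[of "UNIV \<times> D"] penalty rejection] by blast
  show ?thesis
  proof (rule that[OF P])
    show "Re (P z z) \<le> sqnorm (UNIV \<times> D) z" for z
      using le[of z 0] scaleC.linear_0[OF rejection] psd_form.zero_left[OF penalty] by simp
    show "Re (P (v \<otimes> c) (v \<otimes> c)) \<le> sqnorm D (f k) * accept UNIV (T k) v"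
      if c: "\<And>d. d \<in> D \<Longrightarrow> c d = f k d" for v c k
    proof -
      obtain w where
        "sqnorm (UNIV \<times> D) (v \<otimes> c - tilted_rejection T f w) + Re (defect_penalty D T f w w)
          = sqnorm D (f k) * accept UNIV (T k) v"
        using tilted_rejection_sound[of T D c f k v, OF effect c] by blast
      then show ?thesis
        using le[of "v \<otimes> c" w] by simp
    qed
    fix v :: "'i cvec" and c :: "'d cvec"
    obtain w where "Re (P (v \<otimes> c) (v \<otimes> c))
        = sqnorm (UNIV \<times> D) (v \<otimes> c - tilted_rejection T f w) + Re (defect_penalty D T f w w)"
      using attained by blast
    with tilted_rejection_complete[of T \<mu> D f v c w, OF effect \<mu> gram]
    show "sqnorm UNIV v * sqnorm D c - Re (P (v \<otimes> c) (v \<otimes> c))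
       \<le> (\<Sum>k\<in>UNIV. (cmod (cinner D c (f k)))\<^sup>2 / \<mu> * reject UNIV (T k) v)"
      by linarith
  qed
qed

section \<open>Tilting by messages\<close>

datatype error_kind = Wrong_First | Wrong_Second | Wrong_Both

lemma UNIV_error_kind: "UNIV = {Wrong_First, Wrong_Second, Wrong_Both}"
  using error_kind.exhaust by blast

instance error_kind :: finite
  by standard (simp add: UNIV_error_kind)

text \<open>The kind of error made by decoding a message pair \<open>m \<noteq> m'\<close> as \<open>m'\<close>.\<close>

definition error_kind_of :: "'m \<times> 'n \<Rightarrow> 'm \<times> 'n \<Rightarrow> error_kind" where
  "error_kind_of m m' =
     (if snd m = snd m' then Wrong_First else if fst m = fst m' then Wrong_Second else Wrong_Both)"

definition signal_dirs :: "'m \<times> 'n \<Rightarrow> ('m + 'n) set" where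
  "signal_dirs m = {Inl (fst m), Inr (snd m)}"

fun shared_dirs :: "error_kind \<Rightarrow> 'm \<times> 'n \<Rightarrow> ('m + 'n) set" where
  "shared_dirs Wrong_First m = {Inr (snd m)}"
| "shared_dirs Wrong_Second m = {Inl (fst m)}"
| "shared_dirs Wrong_Both m = {}"

lemma finite_signal_dirs: "finite (signal_dirs m)"
  and card_signal_dirs: "card (signal_dirs m) = 2"
  by (simp_all add: signal_dirs_def)

lemma signal_dirs_Int:
  "m \<noteq> m' \<Longrightarrow> signal_dirs m \<inter> signal_dirs m' = shared_dirs (error_kind_of m m') m'"
  by (cases m; cases m') (auto simp: signal_dirs_def error_kind_of_def)

lemma shared_dirs_subset: "shared_dirs k m \<subseteq> signal_dirs m"
  by (cases k) (auto simp: signal_dirs_def)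

lemma card_shared_dirs_le: "card (shared_dirs k m) \<le> 1"
  by (cases k) auto

definition tilt :: "real \<Rightarrow> 'd set \<Rightarrow> 'd option cvec" where
  "tilt \<delta> A d = (case d of None \<Rightarrow> 1 | Some a \<Rightarrow> if a \<in> A then of_real \<delta> else 0)"

definition tilt_space :: "'d set \<Rightarrow> 'd option set" where
  "tilt_space D = insert None (Some ` D)"

lemma cinner_tilt_space: "finite D \<Longrightarrow>
    cinner (tilt_space D) b c = cnj (b None) * c None + (\<Sum>a\<in>D. cnj (b (Some a)) * c (Some a))"
  by (simp add: cinner_def tilt_space_def sum.reindex image_iff)

lemma cinner_tilt:
  assumes "finite D"
  shows "cinner (tilt_space D) (tilt \<delta> A) (tilt \<delta> B) = of_real (1 + \<delta>\<^sup>2 * card (A \<inter> B \<inter> D))"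
proof -
  have "(\<Sum>a\<in>D. cnj (tilt \<delta> A (Some a)) * tilt \<delta> B (Some a))
      = (\<Sum>a\<in>D. if a \<in> A \<inter> B then complex_of_real (\<delta>\<^sup>2) else 0)"
    by (intro sum.cong refl) (simp add: tilt_def power2_eq_square)
  also have "\<dots> = (\<Sum>a\<in>D \<inter> (A \<inter> B). complex_of_real (\<delta>\<^sup>2))"
    by (rule sum.inter_restrict[OF assms, symmetric])
  also have "\<dots> = of_real (\<delta>\<^sup>2 * card (A \<inter> B \<inter> D))"
    by (simp add: Int_commute mult.commute)
  finally show ?thesis
    using assms by (simp add: cinner_tilt_space tilt_def)
qed

lemma cinner_tilt_signal_dirs:
  assumes "finite D" "signal_dirs m \<subseteq> D"
  shows "cinner (tilt_space D) (tilt \<delta> (signal_dirs m)) (tilt \<delta> (signal_dirs m))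
    = of_real (1 + 2 * \<delta>\<^sup>2)"
proof -
  have "signal_dirs m \<inter> D = signal_dirs m"
    using assms(2) by auto
  then show ?thesis
    by (simp add: cinner_tilt[OF assms(1)] card_signal_dirs)
qed

lemma cmod_sq_le_triple:
  "(cmod t\<^sub>3)\<^sup>2 \<le> 3 * ((cmod (t\<^sub>1 + t\<^sub>2 + t\<^sub>3))\<^sup>2 + (cmod t\<^sub>1)\<^sup>2 + (cmod t\<^sub>2)\<^sup>2)"
proof -
  define s where "s = t\<^sub>1 + t\<^sub>2 + t\<^sub>3"
  have "cmod (s - t\<^sub>1 - t\<^sub>2) \<le> cmod s + cmod t\<^sub>1 + cmod t\<^sub>2"
    by (rule order_trans[OF norm_triangle_ineq4 add_right_mono[OF norm_triangle_ineq4]])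
  then have "(cmod t\<^sub>3)\<^sup>2 \<le> (cmod s + cmod t\<^sub>1 + cmod t\<^sub>2)\<^sup>2"
    by (intro power_mono) (simp_all add: s_def)
  also have "\<dots> \<le> 3 * ((cmod s)\<^sup>2 + (cmod t\<^sub>1)\<^sup>2 + (cmod t\<^sub>2)\<^sup>2)"
    using sum_squares_ge_zero[of "cmod s - cmod t\<^sub>1" "cmod s - cmod t\<^sub>2"]
      zero_le_square[of "cmod t\<^sub>1 - cmod t\<^sub>2"]
    by (simp add: power2_eq_square algebra_simps)
  finally show ?thesis
    by (simp add: s_def)
qed

lemma tilt_gram:
  assumes "0 \<le> \<delta>" "\<delta> \<le> 1"
  shows "\<delta>\<^sup>2 / 4 * (\<Sum>k\<in>UNIV. (cmod (t k))\<^sup>2)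
    \<le> sqnorm (tilt_space (signal_dirs m)) (\<Sum>k\<in>UNIV. t k *\<^sub>C tilt \<delta> (shared_dirs k m))"
proof -
  define t\<^sub>1 t\<^sub>2 t\<^sub>3 where t: "t\<^sub>1 = t Wrong_First" "t\<^sub>2 = t Wrong_Second" "t\<^sub>3 = t Wrong_Both"
  have "\<delta>\<^sup>2 \<le> 1"
    using assms by (simp add: power_le_one)
  have "(cmod t\<^sub>3)\<^sup>2 \<le> 3 * ((cmod (t\<^sub>1 + t\<^sub>2 + t\<^sub>3))\<^sup>2 + (cmod t\<^sub>1)\<^sup>2 + (cmod t\<^sub>2)\<^sup>2)"
    by (rule cmod_sq_le_triple)
  then have "\<delta>\<^sup>2 * (cmod t\<^sub>3)\<^sup>2
      \<le> \<delta>\<^sup>2 * (3 * ((cmod (t\<^sub>1 + t\<^sub>2 + t\<^sub>3))\<^sup>2 + (cmod t\<^sub>1)\<^sup>2 + (cmod t\<^sub>2)\<^sup>2))"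
    by (rule mult_left_mono) simp
  moreover have "(3 * \<delta>\<^sup>2) * (cmod (t\<^sub>1 + t\<^sub>2 + t\<^sub>3))\<^sup>2 \<le> 4 * (cmod (t\<^sub>1 + t\<^sub>2 + t\<^sub>3))\<^sup>2"
    using \<open>\<delta>\<^sup>2 \<le> 1\<close> by (intro mult_right_mono) simp_all
  moreover have "sqnorm (tilt_space (signal_dirs m)) (\<Sum>k\<in>UNIV. t k *\<^sub>C tilt \<delta> (shared_dirs k m))
      = (cmod (t\<^sub>1 + t\<^sub>2 + t\<^sub>3))\<^sup>2 + \<delta>\<^sup>2 * (cmod t\<^sub>2)\<^sup>2 + \<delta>\<^sup>2 * (cmod t\<^sub>1)\<^sup>2"
    by (simp add: sqnorm_eq_sum_cmod tilt_space_def signal_dirs_def UNIV_error_kind sum_fun_apply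
        tilt_def norm_mult power_mult_distrib t mult.commute add.assoc)
  moreover have "(\<Sum>k\<in>UNIV. (cmod (t k))\<^sup>2) = (cmod t\<^sub>1)\<^sup>2 + (cmod t\<^sub>2)\<^sup>2 + (cmod t\<^sub>3)\<^sup>2"
    by (simp add: UNIV_error_kind t)
  ultimately show ?thesis
    by (simp add: field_simps)
qed

lemma card_shared_dirs_weighted_le: "1 + (\<delta> :: real)\<^sup>2 * card (shared_dirs k m) \<le> 1 + \<delta>\<^sup>2"
  using mult_left_mono[of "real (card (shared_dirs k m))" 1 "\<delta>\<^sup>2"] card_shared_dirs_le[of k m]
  by simp

lemma cinner_tilt_shared_dirs:
  assumes "shared_dirs k m \<subseteq> A"
  shows "cinner (tilt_space (signal_dirs m)) (tilt \<delta> A) (tilt \<delta> (shared_dirs k m))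
    = of_real (1 + \<delta>\<^sup>2 * card (shared_dirs k m))"
proof -
  have "A \<inter> shared_dirs k m \<inter> signal_dirs m = shared_dirs k m"
    using assms shared_dirs_subset[of k m] by auto
  then show ?thesis
    by (simp add: cinner_tilt finite_signal_dirs)
qed

lemma cmod_cinner_signal_shared_le:
  "cmod (cinner (tilt_space (signal_dirs m)) (tilt \<delta> (signal_dirs m)) (tilt \<delta> (shared_dirs k m)))
    \<le> 1 + \<delta>\<^sup>2"
  using card_shared_dirs_weighted_le
  by (simp only: cinner_tilt_shared_dirs[OF shared_dirs_subset] norm_of_real) simp

lemma sum_cinner_signal_shared_le:
  assumes "\<And>k. 0 \<le> r k"
  shows "(\<Sum>k\<in>UNIV. (cmod (cinner (tilt_space (signal_dirs m)) (tilt \<delta> (signal_dirs m))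
      (tilt \<delta> (shared_dirs k m))))\<^sup>2 / (\<delta>\<^sup>2 / 4) * r k)
    \<le> 4 * (1 + \<delta>\<^sup>2)\<^sup>2 / \<delta>\<^sup>2 * (\<Sum>k\<in>UNIV. r k)"
proof -
  have "(\<Sum>k\<in>UNIV. (cmod (cinner (tilt_space (signal_dirs m)) (tilt \<delta> (signal_dirs m))
      (tilt \<delta> (shared_dirs k m))))\<^sup>2 / (\<delta>\<^sup>2 / 4) * r k)
    \<le> (\<Sum>k\<in>UNIV. (1 + \<delta>\<^sup>2)\<^sup>2 / (\<delta>\<^sup>2 / 4) * r k)"
    using assms cmod_cinner_signal_shared_le
    by (intro sum_mono mult_right_mono divide_right_mono power_mono) simp_all
  also have "\<dots> = 4 * (1 + \<delta>\<^sup>2)\<^sup>2 / \<delta>\<^sup>2 * (\<Sum>k\<in>UNIV. r k)"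
    by (simp only: sum_distrib_left divide_divide_eq_right mult.commute[of _ 4])
  finally show ?thesis .
qed

lemma tilted_joint_test:
  fixes T :: "error_kind \<Rightarrow> ('i::finite) cvec \<Rightarrow> 'i cvec" and m :: "'m \<times> 'n"
  assumes effect: "\<And>k. effect UNIV (T k)" and \<delta>: "0 < \<delta>" "\<delta> \<le> 1"
  defines "signal \<equiv> \<lambda>(v :: 'i cvec) (m' :: 'm \<times> 'n). v \<otimes> tilt \<delta> (signal_dirs m')"
  obtains P where "psd_form P"
    "\<And>z. Re (P z z) \<le> sqnorm (UNIV \<times> tilt_space (signal_dirs m)) z"
    "\<And>v m'. m' \<noteq> m \<Longrightarrow>
       Re (P (signal v m') (signal v m')) \<le> (1 + \<delta>\<^sup>2) * accept UNIV (T (error_kind_of m' m)) v"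
    "\<And>v. (1 + 2 * \<delta>\<^sup>2) * sqnorm UNIV v - Re (P (signal v m) (signal v m))
       \<le> 4 * (1 + \<delta>\<^sup>2)\<^sup>2 / \<delta>\<^sup>2 * (\<Sum>k\<in>UNIV. reject UNIV (T k) v)"
proof -
  define D where "D = tilt_space (signal_dirs m)"
  have "0 < \<delta>\<^sup>2 / 4"
    using \<delta> by simp
  moreover have "\<delta>\<^sup>2 / 4 * (\<Sum>k\<in>UNIV. (cmod (t k))\<^sup>2)
      \<le> sqnorm D (\<Sum>k\<in>UNIV. t k *\<^sub>C tilt \<delta> (shared_dirs k m))" for t
    unfolding D_def using \<delta> by (intro tilt_gram) simp_all
  ultimately obtain P where P: "psd_form P" "\<And>z. Re (P z z) \<le> sqnorm (UNIV \<times> D) z"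
    and sound: "\<And>v c k. (\<And>d. d \<in> D \<Longrightarrow> c d = tilt \<delta> (shared_dirs k m) d) \<Longrightarrow>
      Re (P (v \<otimes> c) (v \<otimes> c)) \<le> sqnorm D (tilt \<delta> (shared_dirs k m)) * accept UNIV (T k) v"
    and complete: "\<And>v c. sqnorm UNIV v * sqnorm D c - Re (P (v \<otimes> c) (v \<otimes> c))
      \<le> (\<Sum>k\<in>UNIV. (cmod (cinner D c (tilt \<delta> (shared_dirs k m))))\<^sup>2 / (\<delta>\<^sup>2 / 4)
          * reject UNIV (T k) v)"
    using joint_test[of T "\<delta>\<^sup>2 / 4" D "\<lambda>k. tilt \<delta> (shared_dirs k m)", OF effect] by blast
  show ?thesis
  proof (rule that[OF P(1) P(2)[unfolded D_def]])
    fix v and m' :: "'m \<times> 'n"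
    assume "m' \<noteq> m"
    define k where "k = error_kind_of m' m"
    have "Re (P (signal v m') (signal v m'))
        \<le> sqnorm D (tilt \<delta> (shared_dirs k m)) * accept UNIV (T k) v"
      unfolding signal_def using signal_dirs_Int[OF \<open>m' \<noteq> m\<close>]
      by (intro sound) (auto simp: D_def tilt_space_def tilt_def k_def)
    also have "\<dots> \<le> (1 + \<delta>\<^sup>2) * accept UNIV (T k) v"
      using card_shared_dirs_weighted_le
      by (intro mult_right_mono accept_nonneg effect) (simp add: D_def cinner_tilt_shared_dirs)
    finally show "Re (P (signal v m') (signal v m'))
        \<le> (1 + \<delta>\<^sup>2) * accept UNIV (T (error_kind_of m' m)) v"
      by (simp add: k_def)
  next
    fix v
    define c where "c = tilt \<delta> (signal_dirs m)"
    have "(\<Sum>k\<in>UNIV. (cmod (cinner D c (tilt \<delta> (shared_dirs k m))))\<^sup>2 / (\<delta>\<^sup>2 / 4)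
          * reject UNIV (T k) v) \<le> 4 * (1 + \<delta>\<^sup>2)\<^sup>2 / \<delta>\<^sup>2 * (\<Sum>k\<in>UNIV. reject UNIV (T k) v)"
      unfolding c_def D_def using accept_le_sqnorm[OF effect]
      by (intro sum_cinner_signal_shared_le) simp
    then show "(1 + 2 * \<delta>\<^sup>2) * sqnorm UNIV v - Re (P (signal v m) (signal v m))
        \<le> 4 * (1 + \<delta>\<^sup>2)\<^sup>2 / \<delta>\<^sup>2 * (\<Sum>k\<in>UNIV. reject UNIV (T k) v)"
      using complete[of v c]
      by (simp add: signal_def c_def D_def cinner_tilt_signal_dirs finite_signal_dirs mult.commute)
  qed
qed

lemma tilted_test:
  fixes T :: "error_kind \<Rightarrow> ('i::finite) cvec \<Rightarrow> 'i cvec" and m :: "'m \<times> 'n"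
  assumes effect: "\<And>k. effect UNIV (T k)" and \<delta>: "0 < \<delta>" "\<delta> \<le> 1"
    and D: "finite D" "signal_dirs m \<subseteq> D"
  obtains E where "effect (UNIV \<times> tilt_space D) E"
    "\<And>v m'. m' \<noteq> m \<Longrightarrow> accept (UNIV \<times> tilt_space D) E (v \<otimes> tilt \<delta> (signal_dirs m'))
       \<le> (1 + \<delta>\<^sup>2) * accept UNIV (T (error_kind_of m' m)) v"
    "\<And>v. reject (UNIV \<times> tilt_space D) E (v \<otimes> tilt \<delta> (signal_dirs m))
       \<le> 4 * (1 + \<delta>\<^sup>2)\<^sup>2 / \<delta>\<^sup>2 * (\<Sum>k\<in>UNIV. reject UNIV (T k) v)"
proof (rule tilted_joint_test[of T \<delta> m, OF effect \<delta>])
  fix P :: "('i \<times> ('m + 'n) option) cvec \<Rightarrow> ('i \<times> ('m + 'n) option) cvec \<Rightarrow> complex"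
  assume P: "psd_form P" "\<And>z. Re (P z z) \<le> sqnorm (UNIV \<times> tilt_space (signal_dirs m)) z"
    and sound: "\<And>v m'. m' \<noteq> m \<Longrightarrow>
       Re (P (v \<otimes> tilt \<delta> (signal_dirs m')) (v \<otimes> tilt \<delta> (signal_dirs m')))
       \<le> (1 + \<delta>\<^sup>2) * accept UNIV (T (error_kind_of m' m)) v"
    and complete: "\<And>v. (1 + 2 * \<delta>\<^sup>2) * sqnorm UNIV v
       - Re (P (v \<otimes> tilt \<delta> (signal_dirs m)) (v \<otimes> tilt \<delta> (signal_dirs m)))
       \<le> 4 * (1 + \<delta>\<^sup>2)\<^sup>2 / \<delta>\<^sup>2 * (\<Sum>k\<in>UNIV. reject UNIV (T k) v)"
  have finite: "finite (UNIV \<times> tilt_space D :: ('i \<times> ('m + 'n) option) set)"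
    using D(1) by (simp add: tilt_space_def)
  then have "Re (P z z) \<le> sqnorm (UNIV \<times> tilt_space D) z" for z
    by (intro order_trans[OF P(2)] sqnorm_mono) (use D(2) in \<open>auto simp: tilt_space_def\<close>)
  then obtain E where "effect (UNIV \<times> tilt_space D) E"
    "\<And>u v. cinner (UNIV \<times> tilt_space D) u (E v) = P u v"
    using effect_of_psd_form[OF P(1) finite] by blast
  moreover have "sqnorm (UNIV \<times> tilt_space D) (v \<otimes> tilt \<delta> (signal_dirs m))
      = (1 + 2 * \<delta>\<^sup>2) * sqnorm UNIV v"
    for v :: "'i cvec"
    using D by (simp add: sqnorm_tensor_vec cinner_tilt_signal_dirs mult.commute)
  ultimately show ?thesis
    using sound complete by (intro that[of E]) simp_all
qed

lemma untilted_miss_le: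
  fixes m :: "'m \<times> 'n"
  assumes "psd_form L" "\<And>z. Re (L z z) \<le> sqnorm (UNIV \<times> tilt_space D) z"
    and "finite D" "signal_dirs m \<subseteq> D"
  shows "sqnorm UNIV v - Re (L (v \<otimes> tilt \<delta> {}) (v \<otimes> tilt \<delta> {}))
    \<le> 2 * (sqnorm (UNIV \<times> tilt_space D) (v \<otimes> tilt \<delta> (signal_dirs m))
          - Re (L (v \<otimes> tilt \<delta> (signal_dirs m)) (v \<otimes> tilt \<delta> (signal_dirs m))))
      + 4 * \<delta>\<^sup>2 * sqnorm UNIV v"
proof -
  define c c\<^sub>0 where "c = tilt \<delta> (signal_dirs m)" and "c\<^sub>0 = tilt \<delta> ({} :: ('m + 'n) set)"
  define miss where "miss = (\<lambda>z w. cinner (UNIV \<times> tilt_space D) z w - L z w)"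
  have "psd_form miss"
    unfolding miss_def by (rule psd_form_diff[OF psd_form_cinner assms(1,2)])
  have norm: "sqnorm (tilt_space D) c\<^sub>0 = 1"
    using assms(3) by (simp add: c\<^sub>0_def cinner_tilt)
  have dist: "sqnorm (tilt_space D) (c - c\<^sub>0) = 2 * \<delta>\<^sup>2"
    using assms(3,4)
    by (simp add: c_def c\<^sub>0_def cinner.sesquilinear cinner_tilt_signal_dirs) (simp add: cinner_tilt)
  have "Re (miss (v \<otimes> c\<^sub>0) (v \<otimes> c\<^sub>0))
      \<le> 2 * Re (miss (v \<otimes> c) (v \<otimes> c)) + 2 * Re (miss (v \<otimes> (c - c\<^sub>0)) (v \<otimes> (c - c\<^sub>0)))"
    unfolding tensor_vec_diff_right by (rule psd_form.Re_le_twice_add_diff[OF \<open>psd_form miss\<close>])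
  also have "Re (miss (v \<otimes> (c - c\<^sub>0)) (v \<otimes> (c - c\<^sub>0))) \<le> sqnorm UNIV v * (2 * \<delta>\<^sup>2)"
    using psd_form.nonneg[OF assms(1), of "v \<otimes> (c - c\<^sub>0)"]
    by (simp only: miss_def minus_complex.sel sqnorm_tensor_vec dist)
  finally show ?thesis
    by (simp add: miss_def c_def c\<^sub>0_def[symmetric] sqnorm_tensor_vec norm mult.commute)
qed

lemma tilted_sequential_decoder:
  fixes T :: "error_kind \<Rightarrow> 'm \<times> 'n \<Rightarrow> ('i::finite) cvec \<Rightarrow> 'i cvec"
  assumes I: "finite I" "I \<noteq> {}" and effect: "\<And>k m. m \<in> I \<Longrightarrow> effect UNIV (T k m)"
    and \<delta>: "0 < \<delta>" "\<delta> \<le> 1" and D: "finite D" "\<And>m. m \<in> I \<Longrightarrow> signal_dirs m \<subseteq> D"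
  defines "S \<equiv> (UNIV :: 'i set) \<times> tilt_space D"
    and "signal \<equiv> \<lambda>(v :: 'i cvec) (m :: 'm \<times> 'n). v \<otimes> tilt \<delta> (signal_dirs m)"
  obtains L where "\<And>m. m \<in> I \<Longrightarrow> psd_form (L m)" "\<And>u v. (\<Sum>m\<in>I. L m u v) = cinner S u v"
    "\<And>m v. m \<in> I \<Longrightarrow> sqnorm S (signal v m) - Re (L m (signal v m) (signal v m))
       \<le> 4 * (4 * (1 + \<delta>\<^sup>2)\<^sup>2 / \<delta>\<^sup>2 * (\<Sum>k\<in>UNIV. reject UNIV (T k m) v)
         + (1 + \<delta>\<^sup>2) * (\<Sum>m'\<in>I - {m}. accept UNIV (T (error_kind_of m m') m') v))"
proof -
  have "\<exists>E. effect S E \<and>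
      (\<forall>v m'. m' \<noteq> m \<longrightarrow> accept S E (signal v m')
        \<le> (1 + \<delta>\<^sup>2) * accept UNIV (T (error_kind_of m' m) m) v) \<and>
      (\<forall>v. reject S E (signal v m) \<le> 4 * (1 + \<delta>\<^sup>2)\<^sup>2 / \<delta>\<^sup>2 * (\<Sum>k\<in>UNIV. reject UNIV (T k m) v))"
    if "m \<in> I" for m
    unfolding S_def signal_def
    by (rule tilted_test[of "\<lambda>k. T k m" \<delta> D m, OF effect[OF that] \<delta> D(1) D(2)[OF that]]) blast
  then obtain E where E: "\<And>m. m \<in> I \<Longrightarrow> effect S (E m)"
    and sound: "\<And>m v m'. m \<in> I \<Longrightarrow> m' \<noteq> m \<Longrightarrow>
      accept S (E m) (signal v m') \<le> (1 + \<delta>\<^sup>2) * accept UNIV (T (error_kind_of m' m) m) v"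
    and complete: "\<And>m v. m \<in> I \<Longrightarrow>
      reject S (E m) (signal v m) \<le> 4 * (1 + \<delta>\<^sup>2)\<^sup>2 / \<delta>\<^sup>2 * (\<Sum>k\<in>UNIV. reject UNIV (T k m) v)"
    by metis
  obtain L where L: "\<And>m. m \<in> I \<Longrightarrow> psd_form (L m)" "\<And>u v. (\<Sum>m\<in>I. L m u v) = cinner S u v"
    and miss: "\<And>m v. m \<in> I \<Longrightarrow>
      sqnorm S v - Re (L m v v) \<le> 4 * (reject S (E m) v + (\<Sum>m'\<in>I - {m}. accept S (E m') v))"
    using sequential_decoder[of I S E, OF I E] by blast
  show ?thesis
  proof (rule that[OF L])
    fix m v
    assume "m \<in> I"
    have "(\<Sum>m'\<in>I - {m}. accept S (E m') (signal v m))
        \<le> (1 + \<delta>\<^sup>2) * (\<Sum>m'\<in>I - {m}. accept UNIV (T (error_kind_of m m') m') v)"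
      unfolding sum_distrib_left by (intro sum_mono sound) auto
    then show "sqnorm S (signal v m) - Re (L m (signal v m) (signal v m))
       \<le> 4 * (4 * (1 + \<delta>\<^sup>2)\<^sup>2 / \<delta>\<^sup>2 * (\<Sum>k\<in>UNIV. reject UNIV (T k m) v)
         + (1 + \<delta>\<^sup>2) * (\<Sum>m'\<in>I - {m}. accept UNIV (T (error_kind_of m m') m') v))"
      by (intro order_trans[OF miss[OF \<open>m \<in> I\<close>]] mult_left_mono add_mono complete[OF \<open>m \<in> I\<close>])
        simp_all
  qed
qed

lemma tilted_decoder:
  fixes T :: "error_kind \<Rightarrow> 'm \<times> 'n \<Rightarrow> ('i::finite) cvec \<Rightarrow> 'i cvec"
  assumes I: "finite I" "I \<noteq> {}" and effect: "\<And>k m. m \<in> I \<Longrightarrow> effect UNIV (T k m)"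
    and \<delta>: "0 < \<delta>" "\<delta> \<le> 1"
  obtains L where "\<And>m. m \<in> I \<Longrightarrow> psd_form (L m)"
    "\<And>u v. (\<Sum>m\<in>I. L m u v) = cinner UNIV u v"
    "\<And>m v. m \<in> I \<Longrightarrow> sqnorm UNIV v - Re (L m v v)
       \<le> 32 * (1 + \<delta>\<^sup>2)\<^sup>2 / \<delta>\<^sup>2 * (\<Sum>k\<in>UNIV. reject UNIV (T k m) v)
        + 8 * (1 + \<delta>\<^sup>2) * (\<Sum>m'\<in>I - {m}. accept UNIV (T (error_kind_of m m') m') v)
        + 4 * \<delta>\<^sup>2 * sqnorm UNIV v"
proof -
  define D where "D = (\<Union>m\<in>I. signal_dirs m)"
  have D: "finite D" "\<And>m. m \<in> I \<Longrightarrow> signal_dirs m \<subseteq> D"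
    using I(1) by (auto simp: D_def finite_signal_dirs)
  obtain L where L: "\<And>m. m \<in> I \<Longrightarrow> psd_form (L m)"
    and total: "\<And>u v. (\<Sum>m\<in>I. L m u v) = cinner (UNIV \<times> tilt_space D) u v"
    and miss: "\<And>m v. m \<in> I \<Longrightarrow> sqnorm (UNIV \<times> tilt_space D) (v \<otimes> tilt \<delta> (signal_dirs m))
        - Re (L m (v \<otimes> tilt \<delta> (signal_dirs m)) (v \<otimes> tilt \<delta> (signal_dirs m)))
       \<le> 4 * (4 * (1 + \<delta>\<^sup>2)\<^sup>2 / \<delta>\<^sup>2 * (\<Sum>k\<in>UNIV. reject UNIV (T k m) v)
         + (1 + \<delta>\<^sup>2) * (\<Sum>m'\<in>I - {m}. accept UNIV (T (error_kind_of m m') m') v))"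
    using tilted_sequential_decoder[of I T \<delta> D, OF I effect \<delta> D] by blast
  have L_le: "Re (L m z z) \<le> sqnorm (UNIV \<times> tilt_space D) z" if "m \<in> I" for m z
    using member_le_sum[OF that, of "\<lambda>m. Re (L m z z)"] psd_form.nonneg[OF L] I(1)
    by (simp flip: total)
  define embed where "embed = (\<lambda>v :: 'i cvec. v \<otimes> tilt \<delta> ({} :: ('m + 'n) set))"
  have embed: "clinear embed"
    unfolding embed_def by (rule clinear_tensor_vec)
  show ?thesis
  proof (rule that[of "\<lambda>m u v. L m (embed u) (embed v)"])
    show "psd_form (\<lambda>u v. L m (embed u) (embed v))" if "m \<in> I" for m
      by (rule psd_form_comp[OF L[OF that] embed])
    show "(\<Sum>m\<in>I. L m (embed u) (embed v)) = cinner UNIV u v" for u v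
      using D(1) by (simp add: total embed_def cinner_tensor_vec cinner_tilt)
    show "sqnorm UNIV v - Re (L m (embed v) (embed v))
       \<le> 32 * (1 + \<delta>\<^sup>2)\<^sup>2 / \<delta>\<^sup>2 * (\<Sum>k\<in>UNIV. reject UNIV (T k m) v)
        + 8 * (1 + \<delta>\<^sup>2) * (\<Sum>m'\<in>I - {m}. accept UNIV (T (error_kind_of m m') m') v)
        + 4 * \<delta>\<^sup>2 * sqnorm UNIV v" if m: "m \<in> I" for m v
      using untilted_miss_le[OF L[OF m] L_le[OF m] D(1) D(2)[OF m], of v \<delta>] miss[OF m, of v]
      unfolding embed_def by argo
  qed
qed

section \<open>Matrices\<close>

definition op_apply :: "('i::finite) op \<Rightarrow> 'i cvec \<Rightarrow> 'i cvec" where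
  "op_apply A v = (\<lambda>i. \<Sum>j\<in>UNIV. A i j * v j)"

definition op_of_form :: "('i cvec \<Rightarrow> 'i cvec \<Rightarrow> complex) \<Rightarrow> 'i op" where
  "op_of_form L = (\<lambda>i j. L (unit_vec i) (unit_vec j))"

definition povm_element :: "('i::finite) op \<Rightarrow> bool" where
  "povm_element X \<longleftrightarrow> psd X \<and> psd (opminus idop X)"

definition Tr :: "('i::finite) op \<Rightarrow> 'i op \<Rightarrow> real" where
  "Tr X A = Re (trace (opmult X A))"

lemma cinner_op_apply:
  "cinner UNIV u (op_apply A v) = (\<Sum>i\<in>UNIV. \<Sum>j\<in>UNIV. cnj (u i) * A i j * v j)"
  by (simp add: cinner_def op_apply_def sum_distrib_left mult.assoc)

lemma cinner_unit_vec: "cinner UNIV (unit_vec i) v = v (i :: 'i::finite)"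
  by (simp add: cinner_def unit_vec_def if_distrib[of "\<lambda>x. x * _"] if_distrib[of cnj] cong: if_cong)

lemma op_apply_unit_vec: "op_apply A (unit_vec j) = (\<lambda>i. A i j)"
  by (simp add: op_apply_def unit_vec_def if_distrib[of "\<lambda>x. _ * x"] cong: if_cong)

lemma op_apply_opminus: "op_apply (opminus A B) v = op_apply A v - op_apply B v"
  by (auto simp: op_apply_def opminus_def fun_eq_iff algebra_simps sum_subtractf)

lemma op_apply_idop: "op_apply idop v = v"
  by (simp add: op_apply_def idop_def fun_eq_iff if_distrib[of "\<lambda>x. x * _"] cong: if_cong)

lemma clinear_op_apply: "clinear (op_apply A)"
  by (rule clinearI) (auto simp: op_apply_def fun_eq_iff algebra_simps sum.distrib sum_distrib_left)

lemma cinner_op_of_form: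
  fixes L :: "('i::finite) cvec \<Rightarrow> 'i cvec \<Rightarrow> complex"
  assumes "psd_form L"
  shows "cinner UNIV u (op_apply (op_of_form L) v) = L u v"
proof -
  interpret psd_form L by fact
  have "L u v = L (\<Sum>i\<in>UNIV. u i *\<^sub>C unit_vec i) (\<Sum>j\<in>UNIV. v j *\<^sub>C unit_vec j)"
    by (simp only: sum_unit_vec)
  also have "\<dots> = (\<Sum>i\<in>UNIV. \<Sum>j\<in>UNIV. cnj (u i) * op_of_form L i j * v j)"
    by (subst sum_left)
      (simp add: sum_right scale_left scale_right op_of_form_def sum_distrib_left mult_ac)
  finally show ?thesis
    by (simp only: cinner_op_apply)
qed

lemma psd_iff_psd_form: "psd A \<longleftrightarrow> psd_form (\<lambda>u v. cinner UNIV u (op_apply A v))"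
proof
  assume "psd_form (\<lambda>u v. cinner UNIV u (op_apply A v))"
  then interpret psd_form "\<lambda>u v. cinner UNIV u (op_apply A v)" .
  show "psd A"
    unfolding psd_def psd_on_def cinner_op_apply[symmetric]
    by (simp add: complex_is_Real_iff Im_diag nonneg)
next
  assume "psd A"
  define B where "B = (\<lambda>u v. cinner UNIV u (op_apply A v))"
  have real: "Im (B v v) = 0" and nonneg: "0 \<le> Re (B v v)" for v
    using \<open>psd A\<close> unfolding psd_def psd_on_def cinner_op_apply[symmetric] B_def
    by (auto simp: complex_is_Real_iff)
  have sesquilinear: "B u (v + w) = B u v + B u w" "B (u + v) w = B u w + B v w"
    "B u (c *\<^sub>C v) = c * B u v" "B (c *\<^sub>C u) v = cnj c * B u v" for u v w c
    by (simp_all only: B_def scaleC.linear_add[OF clinear_op_apply]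
        scaleC.linear_scale[OF clinear_op_apply] cinner.sesquilinear)
  have "cnj (B u v) = B v u" for u v
  proof -
    have "Im (B u v) + Im (B v u) = 0"
      using real[of "u + v"] real[of u] real[of v] by (simp add: sesquilinear)
    moreover have "Re (B u v) - Re (B v u) = 0"
      using real[of "u + \<i> *\<^sub>C v"] real[of u] real[of v] by (simp add: sesquilinear)
    ultimately show ?thesis
      by (simp add: complex_eq_iff)
  qed
  then show "psd_form B"
    by unfold_locales (simp_all add: sesquilinear nonneg)
qed

lemma effect_op_apply:
  assumes "povm_element X"
  shows "effect UNIV (op_apply X)"
proof -
  have "psd_form (\<lambda>u v. cinner UNIV u (op_apply (opminus idop X) v))"
    using assms by (simp add: povm_element_def psd_iff_psd_form)
  then have "0 \<le> Re (cinner UNIV v (op_apply (opminus idop X) v))" for v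
    by (rule psd_form.nonneg)
  then show ?thesis
    using assms by (auto simp: effect_def povm_element_def clinear_op_apply psd_iff_psd_form
        op_apply_opminus op_apply_idop cinner.diff_right)
qed

lemma psd_form_gram:
  assumes "finite J" "psd_form B"
  shows "\<exists>B' \<phi>. psd_form B' \<and> (\<forall>j\<in>J. \<forall>v. B' (unit_vec j) v = 0) \<and>
    (\<forall>u v. B u v = B' u v + (\<Sum>j\<in>J. cnj (\<phi> j u) * \<phi> j v))"
  using assms(1)
proof (induction J rule: finite_induct)
  case empty
  show ?case
    using assms(2) by auto
next
  case (insert a J)
  then obtain B' \<phi> where "psd_form B'" and vanish: "\<forall>j\<in>J. \<forall>v. B' (unit_vec j) v = 0"
    and B_eq: "\<And>u v. B u v = B' u v + (\<Sum>j\<in>J. cnj (\<phi> j u) * \<phi> j v)"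
    by blast
  interpret B': psd_form B' by fact
  define S where "S = schur_complement B' (unit_vec a)"
  define r where "r = Re (B' (unit_vec a) (unit_vec a))"
  have r: "B' (unit_vec a) (unit_vec a) = of_real r" "0 \<le> r"
    using B'.diag_real B'.nonneg by (auto simp: r_def)
  define \<phi>' where "\<phi>' = \<phi>(a := \<lambda>v. B' (unit_vec a) v / of_real (sqrt r))"
  show ?case
  proof (intro exI[of _ S] exI[of _ \<phi>'] conjI ballI allI)
    show "psd_form S"
      unfolding S_def by (rule B'.psd_form_schur_complement)
    show "S (unit_vec j) v = 0" if "j \<in> insert a J" for j v
      using that vanish B'.isotropic_left[of "unit_vec a" v]
      by (cases "j = a"; cases "r = 0") (auto simp: S_def schur_complement_def r)
    fix u v
    have "cnj (\<phi>' a u) * \<phi>' a v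
        = B' u (unit_vec a) * B' (unit_vec a) v / B' (unit_vec a) (unit_vec a)"
      using r by (simp add: \<phi>'_def B'.cnj_commute flip: of_real_mult)
    moreover have "(\<Sum>j\<in>J. cnj (\<phi>' j u) * \<phi>' j v) = (\<Sum>j\<in>J. cnj (\<phi> j u) * \<phi> j v)"
      using insert.hyps(2) by (intro sum.cong) (auto simp: \<phi>'_def)
    ultimately show "B u v = S u v + (\<Sum>j\<in>insert a J. cnj (\<phi>' j u) * \<phi>' j v)"
      using insert.hyps by (simp add: B_eq S_def schur_complement_def)
  qed
qed

lemma psd_gram:
  fixes A :: "('i::finite) op"
  assumes "psd A"
  obtains u :: "'i \<Rightarrow> 'i cvec" where "\<And>i j. A i j = (\<Sum>k\<in>UNIV. u k i * cnj (u k j))"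
proof -
  obtain B' \<phi> where vanish: "\<forall>j\<in>UNIV. \<forall>v. B' (unit_vec j) v = (0 :: complex)"
    and gram: "\<And>v w. cinner UNIV v (op_apply A w)
      = B' v w + (\<Sum>k\<in>(UNIV :: 'i set). cnj (\<phi> k v) * \<phi> k w)"
    using psd_form_gram[OF finite assms[unfolded psd_iff_psd_form]] by blast
  have "A i j = (\<Sum>k\<in>UNIV. cnj (\<phi> k (unit_vec i)) * \<phi> k (unit_vec j))" for i j
    using gram[of "unit_vec i" "unit_vec j"] vanish by (simp add: cinner_unit_vec op_apply_unit_vec)
  then show ?thesis
    by (intro that[of "\<lambda>k i. cnj (\<phi> k (unit_vec i))"]) simp
qed

lemma cinner_gram:
  assumes "\<And>i j. A i j = (\<Sum>k\<in>K. u k i * cnj (u k j))"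
  shows "cinner UNIV v (op_apply A w) = (\<Sum>k\<in>K. cnj (cinner UNIV (u k) v) * cinner UNIV (u k) w)"
proof -
  have "cinner UNIV v (op_apply A w)
      = (\<Sum>i\<in>UNIV. \<Sum>j\<in>UNIV. \<Sum>k\<in>K. (u k i * cnj (v i)) * (cnj (u k j) * w j))"
    by (simp add: cinner_op_apply assms sum_distrib_left sum_distrib_right mult_ac)
  also have "\<dots> = (\<Sum>k\<in>K. \<Sum>i\<in>UNIV. \<Sum>j\<in>UNIV. (u k i * cnj (v i)) * (cnj (u k j) * w j))"
    by (subst sum.swap[of _ K]) (simp add: sum.swap[of _ K])
  also have "\<dots> = (\<Sum>k\<in>K. cnj (cinner UNIV (u k) v) * cinner UNIV (u k) w)"
    by (simp add: cinner_def sum_product)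
  finally show ?thesis .
qed

lemma psd_of_gram:
  assumes "\<And>i j. A i j = (\<Sum>k\<in>K. u k i * cnj (u k j))"
  shows "psd A"
  unfolding psd_iff_psd_form cinner_gram[of A u K, OF assms]
  by unfold_locales (auto simp: cinner.sesquilinear algebra_simps sum.distrib sum_distrib_left
      intro!: sum_nonneg add_nonneg_nonneg)

lemma psd_idop: "psd idop"
  by (rule psd_of_gram[of _ unit_vec UNIV])
    (simp add: idop_def unit_vec_def if_distrib[of "\<lambda>x. x * _"] cong: if_cong)

lemma psd_zero: "psd (\<lambda>i j. 0)"
  by (rule psd_of_gram[of _ _ "{}"]) simp

lemma psd_tensor:
  fixes A :: "('i::finite) op" and B :: "('j::finite) op"
  assumes "psd A" "psd B"
  shows "psd (tensor A B)"
proof -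
  obtain u :: "'i \<Rightarrow> 'i cvec" where u: "\<And>i j. A i j = (\<Sum>k\<in>UNIV. u k i * cnj (u k j))"
    using psd_gram[OF assms(1)] by blast
  obtain v :: "'j \<Rightarrow> 'j cvec" where v: "\<And>i j. B i j = (\<Sum>l\<in>UNIV. v l i * cnj (v l j))"
    using psd_gram[OF assms(2)] by blast
  define w where "w = (\<lambda>(k, l). u k \<otimes> v l)"
  have "tensor A B x y = (\<Sum>kl\<in>UNIV \<times> UNIV. w kl x * cnj (w kl y))" for x y
    by (cases x; cases y)
      (simp add: w_def tensor_def u v sum_product sum.cartesian_product split_def mult_ac)
  then show ?thesis
    by (rule psd_of_gram)
qed

lemma psd_reindex:
  fixes A :: "('i::finite) op"
  assumes "psd A"
  shows "psd (\<lambda>i j. A (e i) (e j))"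
proof -
  obtain u :: "'i \<Rightarrow> 'i cvec" where u: "\<And>i j. A i j = (\<Sum>k\<in>UNIV. u k i * cnj (u k j))"
    using psd_gram[OF assms] by blast
  show ?thesis
    by (rule psd_of_gram[of _ "\<lambda>k i. u k (e i)" UNIV]) (rule u)
qed

lemma povm_element_reindex:
  assumes "povm_element X" "inj e"
  shows "povm_element (\<lambda>i j. X (e i) (e j))"
proof -
  have "opminus idop (\<lambda>i j. X (e i) (e j)) = (\<lambda>i j. opminus idop X (e i) (e j))"
    using assms(2) by (auto simp: opminus_def idop_def fun_eq_iff inj_eq)
  then show ?thesis
    using assms(1) by (simp add: povm_element_def psd_reindex)
qed

lemma trace_tensor: "trace (tensor A B) = trace A * trace B"
  by (simp add: trace_def tensor_def sum_product sum.cartesian_product split_def)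

lemma density_tensor: "density A \<Longrightarrow> density B \<Longrightarrow> density (tensor A B)"
  by (simp add: density_def psd_tensor trace_tensor)

lemma psd_on_trivial_ancilla: "psd_on ({..<1::nat} \<times> UNIV) (\<lambda>(r, i) (r', j). A i j) \<longleftrightarrow> psd A"
proof -
  have ancilla: "{..<1::nat} \<times> UNIV = Pair 0 ` UNIV"
    by auto
  have "psd_on ({..<1::nat} \<times> UNIV) (\<lambda>(r, i) (r', j). A i j)
      \<longleftrightarrow> (\<forall>v :: nat \<times> 'a \<Rightarrow> complex. (\<Sum>i\<in>UNIV. \<Sum>j\<in>UNIV. cnj (v (0, i)) * A i j * v (0, j)) \<in> \<real> \<and>
        0 \<le> Re (\<Sum>i\<in>UNIV. \<Sum>j\<in>UNIV. cnj (v (0, i)) * A i j * v (0, j)))"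
    unfolding psd_on_def ancilla by (simp add: sum.reindex inj_on_def)
  also have "\<dots> \<longleftrightarrow> psd A"
    unfolding psd_def psd_on_def
    by (rule iffI; rule allI) (drule_tac x = "\<lambda>(r, i). v i" in spec, simp, simp)
  finally show ?thesis .
qed

lemma density_quantum_channel:
  assumes "quantum_channel C" "density A"
  shows "density (C A)"
proof -
  have "psd_on ({..<1::nat} \<times> UNIV) (\<lambda>(r, i) (r', j). A i j)"
    using assms(2) by (simp only: psd_on_trivial_ancilla density_def)
  moreover have "completely_positive C"
    using assms(1) by (simp add: quantum_channel_def)
  ultimately have "psd_on ({..<1::nat} \<times> UNIV) (\<lambda>(r, k) (r', k'). C A k k')"
    unfolding completely_positive_def by (force simp: split_def)
  then show ?thesis
    using assms by (simp only: psd_on_trivial_ancilla density_def quantum_channel_def)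
qed

lemma Tr_gram:
  assumes "\<And>i j. A i j = (\<Sum>k\<in>K. u k i * cnj (u k j))"
  shows "Tr X A = (\<Sum>k\<in>K. accept UNIV (op_apply X) (u k))"
proof -
  have "trace (opmult X A) = (\<Sum>i\<in>UNIV. \<Sum>j\<in>UNIV. \<Sum>k\<in>K. cnj (u k i) * X i j * u k j)"
    by (simp add: trace_def opmult_def assms sum_distrib_left mult_ac)
  also have "\<dots> = (\<Sum>k\<in>K. \<Sum>i\<in>UNIV. \<Sum>j\<in>UNIV. cnj (u k i) * X i j * u k j)"
    by (subst sum.swap[of _ K]) (simp add: sum.swap[of _ K])
  finally show ?thesis
    by (simp add: Tr_def cinner_op_apply)
qed

lemma Tr_nonneg:
  fixes A :: "('i::finite) op"
  assumes "psd X" "psd A"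
  shows "0 \<le> Tr X A"
proof -
  obtain u :: "'i \<Rightarrow> 'i cvec" where "\<And>i j. A i j = (\<Sum>k\<in>UNIV. u k i * cnj (u k j))"
    using psd_gram[OF assms(2)] by blast
  then have "Tr X A = (\<Sum>k\<in>UNIV. accept UNIV (op_apply X) (u k))"
    by (rule Tr_gram)
  moreover have "0 \<le> accept UNIV (op_apply X) v" for v
    using psd_form.nonneg[OF assms(1)[unfolded psd_iff_psd_form]] .
  ultimately show ?thesis
    by (simp add: sum_nonneg)
qed

lemma Tr_idop: "Tr idop A = Re (trace A)"
  by (simp add: Tr_def trace_def opmult_def idop_def if_distrib[of "\<lambda>x. x * _"] cong: if_cong)

lemma Tr_opminus: "Tr (opminus X Y) A = Tr X A - Tr Y A"
  by (simp add: Tr_def trace_def opmult_def opminus_def left_diff_distrib sum_subtractf)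

lemma Tr_compl: "density A \<Longrightarrow> Tr (opminus idop X) A = 1 - Tr X A"
  by (simp add: Tr_opminus Tr_idop density_def)

lemma psd_op_of_form: "psd_form L \<Longrightarrow> psd (op_of_form L)"
  by (simp add: psd_iff_psd_form cinner_op_of_form)

lemma density_gram:
  fixes \<rho> :: "('i::finite) op"
  assumes "density \<rho>"
  shows "\<exists>u :: 'i \<Rightarrow> 'i cvec. (\<forall>X. Tr X \<rho> = (\<Sum>l\<in>UNIV. accept UNIV (op_apply X) (u l))) \<and>
    (\<Sum>l\<in>UNIV. sqnorm UNIV (u l)) = 1"
proof -
  have "psd \<rho>"
    using assms by (simp add: density_def)
  then obtain u :: "'i \<Rightarrow> 'i cvec" where "\<And>i j. \<rho> i j = (\<Sum>k\<in>UNIV. u k i * cnj (u k j))"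
    using psd_gram[of \<rho>] by blast
  then have Tr: "Tr X \<rho> = (\<Sum>l\<in>UNIV. accept UNIV (op_apply X) (u l))" for X
    by (rule Tr_gram)
  moreover have "(\<Sum>l\<in>UNIV. sqnorm UNIV (u l)) = 1"
    using Tr[of idop] Tr_idop[of \<rho>] assms by (simp add: op_apply_idop density_def)
  ultimately show ?thesis
    by blast
qed

lemma Tr_compl_le_of_reject_le:
  fixes \<rho> :: "('i::finite) op"
  assumes reject_le: "\<And>v. reject UNIV (op_apply X) v
      \<le> a * (\<Sum>k\<in>K. reject UNIV (op_apply (Y k)) v) + b * (\<Sum>j\<in>J. accept UNIV (op_apply (Z j)) v)
        + c * sqnorm UNIV v"
    and "density \<rho>"
  shows "1 - Tr X \<rho> \<le> a * (\<Sum>k\<in>K. 1 - Tr (Y k) \<rho>) + b * (\<Sum>j\<in>J. Tr (Z j) \<rho>) + c"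
proof -
  obtain u :: "'i \<Rightarrow> 'i cvec" where Tr: "\<And>X. Tr X \<rho> = (\<Sum>l\<in>UNIV. accept UNIV (op_apply X) (u l))"
    and sqnorm: "(\<Sum>l\<in>UNIV. sqnorm UNIV (u l)) = 1"
    using density_gram[OF \<open>density \<rho>\<close>] by blast
  have compl: "1 - Tr X \<rho> = (\<Sum>l\<in>UNIV. reject UNIV (op_apply X) (u l))" for X
    by (simp only: Tr sum_subtractf sqnorm)
  have "1 - Tr X \<rho> \<le> (\<Sum>l\<in>UNIV. a * (\<Sum>k\<in>K. reject UNIV (op_apply (Y k)) (u l))
      + b * (\<Sum>j\<in>J. accept UNIV (op_apply (Z j)) (u l)) + c * sqnorm UNIV (u l))"
    unfolding compl by (intro sum_mono reject_le)
  also have "\<dots> = a * (\<Sum>l\<in>UNIV. \<Sum>k\<in>K. reject UNIV (op_apply (Y k)) (u l))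
      + b * (\<Sum>l\<in>UNIV. \<Sum>j\<in>J. accept UNIV (op_apply (Z j)) (u l)) + c * (\<Sum>l\<in>UNIV. sqnorm UNIV (u l))"
    by (simp only: sum.distrib sum_distrib_left)
  also have "\<dots> = a * (\<Sum>k\<in>K. 1 - Tr (Y k) \<rho>) + b * (\<Sum>j\<in>J. Tr (Z j) \<rho>) + c"
    by (subst (1 2) sum.swap) (simp only: compl[symmetric] Tr[symmetric] sqnorm mult_1_right)
  finally show ?thesis .
qed

lemma tilted_povm:
  fixes T :: "error_kind \<Rightarrow> 'm \<times> 'n \<Rightarrow> ('i::finite) op"
  assumes I: "finite I" "I \<noteq> {}" and T: "\<And>k m. m \<in> I \<Longrightarrow> povm_element (T k m)"
    and \<delta>: "0 < \<delta>" "\<delta> \<le> 1"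
  obtains \<Lambda> where "\<And>m. m \<in> I \<Longrightarrow> psd (\<Lambda> m)" "\<And>i j. (\<Sum>m\<in>I. \<Lambda> m i j) = idop i j"
    "\<And>m \<rho>. m \<in> I \<Longrightarrow> density \<rho> \<Longrightarrow> 1 - Tr (\<Lambda> m) \<rho>
       \<le> 32 * (1 + \<delta>\<^sup>2)\<^sup>2 / \<delta>\<^sup>2 * (\<Sum>k\<in>UNIV. 1 - Tr (T k m) \<rho>)
        + 8 * (1 + \<delta>\<^sup>2) * (\<Sum>m'\<in>I - {m}. Tr (T (error_kind_of m m') m') \<rho>) + 4 * \<delta>\<^sup>2"
proof -
  obtain L where L: "\<And>m. m \<in> I \<Longrightarrow> psd_form (L m)"
    and total: "\<And>u v. (\<Sum>m\<in>I. L m u v) = cinner UNIV u v"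
    and miss: "\<And>m v. m \<in> I \<Longrightarrow> sqnorm UNIV v - Re (L m v v)
       \<le> 32 * (1 + \<delta>\<^sup>2)\<^sup>2 / \<delta>\<^sup>2 * (\<Sum>k\<in>UNIV. reject UNIV (op_apply (T k m)) v)
        + 8 * (1 + \<delta>\<^sup>2) * (\<Sum>m'\<in>I - {m}. accept UNIV (op_apply (T (error_kind_of m m') m')) v)
        + 4 * \<delta>\<^sup>2 * sqnorm UNIV v"
    using tilted_decoder[of I "\<lambda>k m. op_apply (T k m)" \<delta>, OF I effect_op_apply[OF T] \<delta>] by blast
  show ?thesis
  proof (rule that[of "\<lambda>m. op_of_form (L m)"])
    show "psd (op_of_form (L m))" if "m \<in> I" for m
      by (rule psd_op_of_form[OF L[OF that]])
    show "(\<Sum>m\<in>I. op_of_form (L m) i j) = idop i j" for i j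
      by (simp add: op_of_form_def total cinner_unit_vec) (simp add: unit_vec_def idop_def)
    show "1 - Tr (op_of_form (L m)) \<rho>
       \<le> 32 * (1 + \<delta>\<^sup>2)\<^sup>2 / \<delta>\<^sup>2 * (\<Sum>k\<in>UNIV. 1 - Tr (T k m) \<rho>)
        + 8 * (1 + \<delta>\<^sup>2) * (\<Sum>m'\<in>I - {m}. Tr (T (error_kind_of m m') m') \<rho>) + 4 * \<delta>\<^sup>2"
      if "m \<in> I" "density \<rho>" for m \<rho>
      by (rule Tr_compl_le_of_reject_le[OF _ \<open>density \<rho>\<close>],
          unfold cinner_op_of_form[OF L[OF \<open>m \<in> I\<close>]], rule miss[OF \<open>m \<in> I\<close>])
  qed
qed

section \<open>Random codebooks\<close>

abbreviation expect :: "'a pmf \<Rightarrow> ('a \<Rightarrow> 'b::{banach, second_countable_topology}) \<Rightarrow> 'b" where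
  "expect \<equiv> measure_pmf.expectation"

lemma integrable_finite_type [simp]:
  fixes f :: "'a::finite \<Rightarrow> 'b::{banach, second_countable_topology}"
  shows "integrable (measure_pmf p) f"
  by (rule integrable_measure_pmf_finite) simp

lemma expect_bind_pmf:
  fixes p :: "'a::finite pmf" and f :: "'a \<Rightarrow> 'b::finite pmf"
    and h :: "'b \<Rightarrow> 'c::{banach, second_countable_topology}"
  shows "expect (bind_pmf p f) h = expect p (\<lambda>a. expect (f a) h)"
proof -
  have "expect (bind_pmf p f) h = (\<Sum>a\<in>UNIV. pmf p a *\<^sub>R expect (f a) h)"
    by (rule pmf_expectation_bind) auto
  also have "\<dots> = expect p (\<lambda>a. expect (f a) h)"
    by (rule integral_measure_pmf[symmetric]) auto
  finally show ?thesis .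
qed

lemma exists_le_expect:
  fixes \<phi> :: "'a \<Rightarrow> real"
  assumes "finite (set_pmf p)" "expect p \<phi> \<le> c"
  obtains x where "\<phi> x \<le> c"
proof -
  have "\<not> (\<forall>x. c < \<phi> x)"
    using measure_pmf.expectation_greater[OF integrable_measure_pmf_finite[OF assms(1)], of c \<phi>]
      assms(2)
    by auto
  then show ?thesis
    using that not_less by blast
qed

definition codebook_pmf :: "nat \<Rightarrow> 'x pmf \<Rightarrow> (nat \<Rightarrow> 'x) pmf" where
  "codebook_pmf N P = Pi_pmf {..<N} undefined (\<lambda>_. P)"

text \<open>The conditional distribution of the transmitted pair of code letters, given the pair of a
  competing message that differs from the transmitted one by the given kind of error.\<close>

fun transmitted_pmf :: "'x pmf \<Rightarrow> 'y pmf \<Rightarrow> error_kind \<Rightarrow> 'x \<times> 'y \<Rightarrow> ('x \<times> 'y) pmf" where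
  "transmitted_pmf P Q Wrong_First (x, y) = map_pmf (\<lambda>x'. (x', y)) P"
| "transmitted_pmf P Q Wrong_Second (x, y) = map_pmf (\<lambda>y'. (x, y')) Q"
| "transmitted_pmf P Q Wrong_Both (x, y) = pair_pmf P Q"

lemma finite_set_codebook_pmf: "finite (set_pmf (codebook_pmf N (P :: 'x::finite pmf)))"
  unfolding codebook_pmf_def by (subst set_Pi_pmf) auto

lemma map_codebook_pmf: "m < N \<Longrightarrow> map_pmf (\<lambda>f. f m) (codebook_pmf N P) = P"
  by (simp add: codebook_pmf_def Pi_pmf_component)

definition letter_pair_pmf :: "bool \<Rightarrow> 'x pmf \<Rightarrow> ('x \<times> 'x) pmf" where
  "letter_pair_pmf same P = (if same then map_pmf (\<lambda>x. (x, x)) P else pair_pmf P P)"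

lemma map_codebook_pmf_pair:
  assumes "j < N" "m < N"
  shows "map_pmf (\<lambda>f. (f j, f m)) (codebook_pmf N P) = letter_pair_pmf (j = m) P"
proof (cases "j = m")
  case True
  then show ?thesis
    using arg_cong[OF map_codebook_pmf[OF assms(1), of P], of "map_pmf (\<lambda>x. (x, x))"]
    by (simp add: letter_pair_pmf_def map_pmf_comp)
next
  case False
  define A where "A = {..<N} - {j}"
  have A: "{..<N} = insert j A" "finite A" "j \<notin> A" "m \<in> A"
    using assms False by (auto simp: A_def)
  have "map_pmf (\<lambda>f. (f j, f m)) (codebook_pmf N P)
      = map_pmf (\<lambda>(x, f). (x, f m)) (pair_pmf P (Pi_pmf A undefined (\<lambda>_. P)))"
    using A(2,3) False by (simp add: codebook_pmf_def A(1) Pi_pmf_insert map_pmf_comp split_def)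
  also have "\<dots> = pair_pmf P (map_pmf (\<lambda>f. f m) (Pi_pmf A undefined (\<lambda>_. P)))"
    using map_pair[of "\<lambda>x. x" "\<lambda>f. f m"] by simp
  finally show ?thesis
    using A(2,4) False by (simp add: Pi_pmf_component letter_pair_pmf_def)
qed

lemma bind_transmitted_pmf:
  "bind_pmf (pair_pmf P Q) (\<lambda>c. map_pmf (Pair c) (transmitted_pmf P Q k c))
    = map_pmf (\<lambda>((x', x), (y', y)). ((x', y'), (x, y)))
        (pair_pmf (letter_pair_pmf (k = Wrong_Second) P) (letter_pair_pmf (k = Wrong_First) Q))"
proof (cases k)
  case Wrong_First
  have "bind_pmf P (\<lambda>x'. bind_pmf P (\<lambda>x. bind_pmf Q (\<lambda>y. return_pmf ((x', y), (x, y)))))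
      = bind_pmf P (\<lambda>x'. bind_pmf Q (\<lambda>y. bind_pmf P (\<lambda>x. return_pmf ((x', y), (x, y)))))"
    by (subst bind_commute_pmf) (rule refl)
  then show ?thesis
    by (simp add: Wrong_First letter_pair_pmf_def pair_pmf_def map_pmf_def bind_assoc_pmf
        bind_return_pmf)
next
  case Wrong_Second
  then show ?thesis
    by (simp add: letter_pair_pmf_def pair_pmf_def map_pmf_def bind_assoc_pmf bind_return_pmf)
next
  case Wrong_Both
  have "bind_pmf P (\<lambda>x'. bind_pmf P (\<lambda>x. bind_pmf Q (\<lambda>y'. bind_pmf Q (\<lambda>y.
          return_pmf ((x', y'), (x, y))))))
      = bind_pmf P (\<lambda>x'. bind_pmf Q (\<lambda>y'. bind_pmf P (\<lambda>x. bind_pmf Q (\<lambda>y.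
          return_pmf ((x', y'), (x, y))))))"
    by (subst bind_commute_pmf) (rule refl)
  then show ?thesis
    by (simp add: Wrong_Both letter_pair_pmf_def pair_pmf_def map_pmf_def bind_assoc_pmf
        bind_return_pmf)
qed

definition mac_codebook_pmf :: "nat \<Rightarrow> nat \<Rightarrow> 'x pmf \<Rightarrow> 'y pmf \<Rightarrow> ((nat \<Rightarrow> 'x) \<times> (nat \<Rightarrow> 'y)) pmf" where
  "mac_codebook_pmf M1 M2 P Q = pair_pmf (codebook_pmf M1 P) (codebook_pmf M2 Q)"

definition codeword :: "(nat \<Rightarrow> 'x) \<times> (nat \<Rightarrow> 'y) \<Rightarrow> nat \<times> nat \<Rightarrow> 'x \<times> 'y" where
  "codeword c = map_prod (fst c) (snd c)"

lemma map_codeword_pmf: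
  assumes "m \<in> {..<M1} \<times> {..<M2}"
  shows "map_pmf (\<lambda>c. codeword c m) (mac_codebook_pmf M1 M2 P Q) = pair_pmf P Q"
proof -
  have "map_pmf (\<lambda>c. codeword c m) (mac_codebook_pmf M1 M2 P Q)
      = pair_pmf (map_pmf (\<lambda>f. f (fst m)) (codebook_pmf M1 P))
          (map_pmf (\<lambda>g. g (snd m)) (codebook_pmf M2 Q))"
    unfolding map_pair[symmetric]
    by (simp add: mac_codebook_pmf_def codeword_def map_prod_def split_def)
  then show ?thesis
    using assms by (auto simp: map_codebook_pmf)
qed

lemma map_codeword_pair_pmf:
  assumes "m \<in> {..<M1} \<times> {..<M2}" "m' \<in> {..<M1} \<times> {..<M2}" "m \<noteq> m'"
  shows "map_pmf (\<lambda>c. (codeword c m', codeword c m)) (mac_codebook_pmf M1 M2 P Q)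
    = bind_pmf (pair_pmf P Q)
        (\<lambda>c'. map_pmf (Pair c') (transmitted_pmf P Q (error_kind_of m m') c'))"
proof -
  have "map_pmf (\<lambda>c. (codeword c m', codeword c m)) (mac_codebook_pmf M1 M2 P Q)
      = map_pmf (\<lambda>((x', x), (y', y)). ((x', y'), (x, y)))
          (pair_pmf (map_pmf (\<lambda>f. (f (fst m'), f (fst m))) (codebook_pmf M1 P))
                    (map_pmf (\<lambda>g. (g (snd m'), g (snd m))) (codebook_pmf M2 Q)))"
    unfolding map_pair[symmetric] map_pmf_comp
    by (simp add: mac_codebook_pmf_def codeword_def map_prod_def split_def)
  moreover have "map_pmf (\<lambda>f. (f (fst m'), f (fst m))) (codebook_pmf M1 P)
      = letter_pair_pmf (error_kind_of m m' = Wrong_Second) P"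
    using assms by (subst map_codebook_pmf_pair)
      (auto simp: error_kind_of_def intro!: arg_cong2[of _ _ _ _ letter_pair_pmf])
  moreover have "map_pmf (\<lambda>g. (g (snd m'), g (snd m))) (codebook_pmf M2 Q)
      = letter_pair_pmf (error_kind_of m m' = Wrong_First) Q"
    using assms by (subst map_codebook_pmf_pair)
      (auto simp: error_kind_of_def intro!: arg_cong2[of _ _ _ _ letter_pair_pmf])
  ultimately show ?thesis
    by (simp only: bind_transmitted_pmf)
qed

lemma finite_set_mac_codebook_pmf:
  fixes P :: "'x::finite pmf" and Q :: "'y::finite pmf"
  shows "finite (set_pmf (mac_codebook_pmf M1 M2 P Q))"
  by (simp add: mac_codebook_pmf_def finite_set_codebook_pmf)

lemma expect_codeword:
  assumes "m \<in> {..<M1} \<times> {..<M2}"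
  shows "expect (mac_codebook_pmf M1 M2 P Q) (\<lambda>c. h (codeword c m)) = expect (pair_pmf P Q) h"
  by (simp flip: map_codeword_pmf[OF assms])

lemma expect_codeword_pair:
  fixes P :: "'x::finite pmf" and Q :: "'y::finite pmf"
  assumes "m \<in> {..<M1} \<times> {..<M2}" "m' \<in> {..<M1} \<times> {..<M2}" "m \<noteq> m'"
  shows "expect (mac_codebook_pmf M1 M2 P Q) (\<lambda>c. g (codeword c m') (codeword c m))
    = expect (pair_pmf P Q) (\<lambda>c'. expect (transmitted_pmf P Q (error_kind_of m m') c') (g c'))"
proof -
  have "expect (mac_codebook_pmf M1 M2 P Q) (\<lambda>c. g (codeword c m') (codeword c m))
      = expect (map_pmf (\<lambda>c. (codeword c m', codeword c m)) (mac_codebook_pmf M1 M2 P Q))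
          (case_prod g)"
    by simp
  then show ?thesis
    unfolding map_codeword_pair_pmf[OF assms] by (simp add: expect_bind_pmf)
qed

fun num_competitors :: "nat \<Rightarrow> nat \<Rightarrow> error_kind \<Rightarrow> nat" where
  "num_competitors M1 M2 Wrong_First = M1"
| "num_competitors M1 M2 Wrong_Second = M2"
| "num_competitors M1 M2 Wrong_Both = M1 * M2"

lemma num_competitors_pos: "0 < M1 \<Longrightarrow> 0 < M2 \<Longrightarrow> 0 < num_competitors M1 M2 k"
  by (cases k) auto

lemma card_competitors_le:
  fixes m :: "nat \<times> nat"
  shows "card {m' \<in> {..<M1} \<times> {..<M2} - {m}. error_kind_of m m' = k} \<le> num_competitors M1 M2 k"
proof -
  define S where "S = (case k of
      Wrong_First \<Rightarrow> {..<M1} \<times> {snd m}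
    | Wrong_Second \<Rightarrow> {fst m} \<times> {..<M2}
    | Wrong_Both \<Rightarrow> {..<M1} \<times> {..<M2})"
  have "finite S" "card S = num_competitors M1 M2 k"
    by (cases k; simp add: S_def)+
  moreover have "{m' \<in> {..<M1} \<times> {..<M2} - {m}. error_kind_of m m' = k} \<subseteq> S"
    by (cases k) (auto simp: S_def error_kind_of_def split: if_splits)
  ultimately show ?thesis
    using card_mono by fastforce
qed

lemma sum_competitors_le:
  fixes m :: "nat \<times> nat" and S :: "error_kind \<Rightarrow> real"
  assumes "\<And>k. 0 \<le> S k"
  shows "(\<Sum>m'\<in>{..<M1} \<times> {..<M2} - {m}. S (error_kind_of m m'))
    \<le> (\<Sum>k\<in>UNIV. num_competitors M1 M2 k * S k)"
proof -
  have "(\<Sum>m'\<in>{..<M1} \<times> {..<M2} - {m}. S (error_kind_of m m'))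
      = (\<Sum>k\<in>UNIV. real (card {m' \<in> {..<M1} \<times> {..<M2} - {m}. error_kind_of m m' = k}) * S k)"
    by (rule sum_fun_comp) auto
  also have "\<dots> \<le> (\<Sum>k\<in>UNIV. num_competitors M1 M2 k * S k)"
    using assms card_competitors_le by (intro sum_mono mult_right_mono) (auto simp del: of_nat_mult)
  finally show ?thesis .
qed

lemma random_codebook:
  fixes P :: "'x::finite pmf" and Q :: "'y::finite pmf" and h :: "'x \<times> 'y \<Rightarrow> real"
    and g :: "error_kind \<Rightarrow> 'x \<times> 'y \<Rightarrow> 'x \<times> 'y \<Rightarrow> real"
  assumes M: "0 < M1" "0 < M2" and K: "0 \<le> K" and g: "\<And>k c' c. 0 \<le> g k c' c"
    and h_le: "expect (pair_pmf P Q) h \<le> H"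
    and g_le: "\<And>k. num_competitors M1 M2 k
      * expect (pair_pmf P Q) (\<lambda>c'. expect (transmitted_pmf P Q k c') (g k c')) \<le> \<epsilon>"
  obtains c where "(\<Sum>m\<in>{..<M1} \<times> {..<M2}. h (codeword c m) + K * (\<Sum>m'\<in>{..<M1} \<times> {..<M2} - {m}.
      g (error_kind_of m m') (codeword c m') (codeword c m))) / (real M1 * real M2) \<le> H + 3 * K * \<epsilon>"
proof -
  let ?I = "{..<M1} \<times> {..<M2}"
  define \<mu> where "\<mu> = mac_codebook_pmf M1 M2 P Q"
  note [simp] =
    integrable_measure_pmf_finite[OF finite_set_mac_codebook_pmf[of M1 M2 P Q, folded \<mu>_def]]
  define S where "S = (\<lambda>k. expect (pair_pmf P Q) (\<lambda>c'. expect (transmitted_pmf P Q k c') (g k c')))"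
  have "0 \<le> S k" for k
    unfolding S_def using g by (intro Bochner_Integration.integral_nonneg) auto
  have competitors:
    "(\<Sum>m'\<in>?I - {m}. expect \<mu> (\<lambda>c. g (error_kind_of m m') (codeword c m') (codeword c m)))
      \<le> 3 * \<epsilon>" if "m \<in> ?I" for m
  proof -
    have "(\<Sum>m'\<in>?I - {m}. expect \<mu> (\<lambda>c. g (error_kind_of m m') (codeword c m') (codeword c m)))
        = (\<Sum>m'\<in>?I - {m}. S (error_kind_of m m'))"
      unfolding \<mu>_def S_def using that by (intro sum.cong refl expect_codeword_pair) auto
    also have "\<dots> \<le> (\<Sum>k\<in>UNIV. num_competitors M1 M2 k * S k)"
      by (rule sum_competitors_le) fact
    also have "\<dots> \<le> (\<Sum>k\<in>(UNIV :: error_kind set). \<epsilon>)"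
      unfolding S_def by (intro sum_mono g_le)
    finally show ?thesis
      by (simp add: UNIV_error_kind)
  qed
  define err where "err = (\<lambda>c. (\<Sum>m\<in>?I. h (codeword c m)
    + K * (\<Sum>m'\<in>?I - {m}. g (error_kind_of m m') (codeword c m') (codeword c m)))
      / (real M1 * real M2))"
  have "expect \<mu> err = (\<Sum>m\<in>?I. expect \<mu> (\<lambda>c. h (codeword c m)) + K * (\<Sum>m'\<in>?I - {m}.
      expect \<mu> (\<lambda>c. g (error_kind_of m m') (codeword c m') (codeword c m)))) / (real M1 * real M2)"
    by (simp add: err_def)
  also have "\<dots> \<le> (\<Sum>m\<in>?I. H + K * (3 * \<epsilon>)) / (real M1 * real M2)"
    using h_le competitors K
    by (intro divide_right_mono sum_mono add_mono mult_left_mono)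
      (simp_all add: \<mu>_def expect_codeword)
  also have "\<dots> = H + 3 * K * \<epsilon>"
    using M by simp
  finally obtain c where "err c \<le> H + 3 * K * \<epsilon>"
    using exists_le_expect[OF finite_set_mac_codebook_pmf] unfolding \<mu>_def by blast
  then show ?thesis
    using that by (simp add: err_def)
qed

section \<open>Tests for classical-quantum states\<close>

lemma DH_test:
  fixes \<alpha> \<beta> :: "('i::finite) op"
  assumes le: "ereal (log 2 N) \<le> DH \<epsilon> \<alpha> \<beta> - ereal (1 + log 2 (1 / \<epsilon>))" and "0 < \<epsilon>" "0 < N"
  obtains X where "povm_element X" "1 - \<epsilon> \<le> Tr X \<alpha>" "N * Tr X \<beta> \<le> \<epsilon>"
proof -
  define c where "c = log 2 (N / \<epsilon>)"
  have "c = log 2 N + log 2 (1 / \<epsilon>)"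
    using assms(2,3) by (simp add: c_def log_divide)
  then have "ereal c < DH \<epsilon> \<alpha> \<beta>"
    using le by (cases "DH \<epsilon> \<alpha> \<beta>") auto
  then obtain X where X: "povm_element X" "1 - \<epsilon> \<le> Tr X \<alpha>"
    and c_less: "ereal c < (if Tr X \<beta> > 0 then ereal (- log 2 (Tr X \<beta>)) else PInfty)"
    unfolding DH_def less_SUP_iff Tr_def povm_element_def by auto
  have "N * Tr X \<beta> \<le> \<epsilon>"
  proof (cases "Tr X \<beta> > 0")
    case True
    then have "log 2 (Tr X \<beta>) < - c"
      using c_less by simp
    also have "- c = log 2 (\<epsilon> / N)"
      using assms(2,3) by (simp add: c_def log_divide)
    finally have "Tr X \<beta> < \<epsilon> / N"
      using True assms(2,3) by (subst (asm) log_less_cancel_iff) auto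
    then show ?thesis
      using assms(3) by (simp add: field_simps)
  next
    case False
    then have "N * Tr X \<beta> \<le> 0"
      using assms(3) by (simp add: mult_le_0_iff)
    then show ?thesis
      using assms(2) by simp
  qed
  then show ?thesis
    using X that by blast
qed

definition cq :: "'k pmf \<Rightarrow> ('k \<Rightarrow> 'i op) \<Rightarrow> ('k \<times> 'i) op" where
  "cq W \<rho> = (\<lambda>(k, i) (k', j). if k = k' then complex_of_real (pmf W k) * \<rho> k i j else 0)"

definition mean_op :: "'k pmf \<Rightarrow> ('k \<Rightarrow> 'i op) \<Rightarrow> 'i op" where
  "mean_op W \<rho> = (\<lambda>i j. expect W (\<lambda>k. \<rho> k i j))"

definition ccq :: "'x pmf \<Rightarrow> 'y pmf \<Rightarrow> ('x \<times> 'y \<Rightarrow> 'i op) \<Rightarrow> ('x \<times> 'y \<times> 'i) op" where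
  "ccq P Q \<rho> = (\<lambda>(x, y, i) (x', y', j). cq (pair_pmf P Q) \<rho> ((x, y), i) ((x', y'), j))"

lemma cq_apply:
  "cq W \<rho> (k, i) (k', j) = (if k = k' then complex_of_real (pmf W k) * \<rho> k i j else 0)"
  by (simp add: cq_def)

lemma cq_swap:
  "cq (pair_pmf Q P) \<rho> ((y, x), i) ((y', x'), j)
    = cq (pair_pmf P Q) (\<lambda>(x, y). \<rho> (y, x)) ((x, y), i) ((x', y'), j)"
  by (auto simp: cq_def pmf_pair)

lemma mean_op_eq_sum:
  "mean_op W \<rho> i j = (\<Sum>k\<in>UNIV. complex_of_real (pmf W k) * \<rho> (k :: 'k::finite) i j)"
  by (simp add: mean_op_def integral_measure_pmf[of UNIV] scaleR_conv_of_real)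

lemma mean_op_map_pmf: "mean_op (map_pmf f W) \<rho> = mean_op W (\<lambda>k. \<rho> (f k))"
  by (simp add: mean_op_def)

lemma sum_complex_pmf: "(\<Sum>k\<in>UNIV. complex_of_real (pmf W (k :: 'k::finite))) = 1"
  using sum_pmf_eq_1[of UNIV W] by (simp flip: of_real_sum)

lemma Tr_mean_op:
  fixes W :: "'k::finite pmf"
  shows "Tr X (mean_op W \<rho>) = expect W (\<lambda>k. Tr X (\<rho> k))"
proof -
  have "trace (opmult X (mean_op W \<rho>)) = expect W (\<lambda>k. trace (opmult X (\<rho> k)))"
    by (simp add: trace_def opmult_def mean_op_def)
  then show ?thesis
    by (simp add: Tr_def)
qed

lemma Tr_cq:
  fixes X :: "('k::finite \<times> 'i::finite) op"
  shows "Tr X (cq W \<rho>) = expect W (\<lambda>k. Tr (\<lambda>i j. X (k, i) (k, j)) (\<rho> k))"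
proof -
  have "(\<Sum>l\<in>UNIV. X (k, i) l * cq W \<rho> l (k, i))
      = (\<Sum>j\<in>UNIV. complex_of_real (pmf W k) * (X (k, i) (k, j) * \<rho> k j i))" for k i
    unfolding UNIV_Times_UNIV[symmetric] sum.cartesian_product'
    by (subst sum.swap)
      (simp add: cq_apply if_distrib[of "\<lambda>x. _ * x"] mult_ac cong: if_cong)
  then have "trace (opmult X (cq W \<rho>))
      = (\<Sum>k\<in>UNIV. complex_of_real (pmf W k) * trace (opmult (\<lambda>i j. X (k, i) (k, j)) (\<rho> k)))"
    unfolding trace_def opmult_def UNIV_Times_UNIV[symmetric] sum.cartesian_product'
    by (simp add: sum_distrib_left)
  then show ?thesis
    by (simp add: Tr_def integral_measure_pmf[of UNIV])
qed

lemma Tr_reindex: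
  assumes "bij \<phi>"
  shows "Tr (\<lambda>i j. X (\<phi> i) (\<phi> j)) (\<lambda>i j. A (\<phi> i) (\<phi> j)) = Tr X A"
proof -
  have "(\<Sum>i\<in>UNIV. \<Sum>k\<in>UNIV. X i k * A k i) = (\<Sum>i\<in>UNIV. \<Sum>k\<in>UNIV. X (\<phi> i) k * A k (\<phi> i))"
    by (rule sum.reindex_bij_betw[OF assms, symmetric])
  also have "\<dots> = (\<Sum>i\<in>UNIV. \<Sum>k\<in>UNIV. X (\<phi> i) (\<phi> k) * A (\<phi> k) (\<phi> i))"
    by (intro sum.cong refl sum.reindex_bij_betw[OF assms, symmetric])
  finally show ?thesis
    by (simp only: Tr_def trace_def opmult_def)
qed

lemma DH_le_reindex:
  assumes "bij \<phi>"
  shows "DH \<epsilon> \<alpha> \<beta> \<le> DH \<epsilon> (\<lambda>i j. \<alpha> (\<phi> i) (\<phi> j)) (\<lambda>i j. \<beta> (\<phi> i) (\<phi> j))"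
  unfolding DH_def Tr_def[symmetric]
proof (rule SUP_mono)
  fix X
  assume "X \<in> {X. psd X \<and> psd (opminus idop X) \<and> 1 - \<epsilon> \<le> Tr X \<alpha>}"
  then have "povm_element X" "1 - \<epsilon> \<le> Tr X \<alpha>"
    by (auto simp: povm_element_def)
  then show "\<exists>Y\<in>{Y. psd Y \<and> psd (opminus idop Y) \<and> 1 - \<epsilon> \<le> Tr Y (\<lambda>i j. \<alpha> (\<phi> i) (\<phi> j))}.
      (if Tr X \<beta> > 0 then ereal (- log 2 (Tr X \<beta>)) else PInfty)
      \<le> (if Tr Y (\<lambda>i j. \<beta> (\<phi> i) (\<phi> j)) > 0
          then ereal (- log 2 (Tr Y (\<lambda>i j. \<beta> (\<phi> i) (\<phi> j)))) else PInfty)"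
    using povm_element_reindex[OF _ bij_is_inj[OF assms], of X]
    by (intro bexI[of _ "\<lambda>i j. X (\<phi> i) (\<phi> j)"]) (auto simp: povm_element_def Tr_reindex[OF assms])
qed

lemma cq_test:
  fixes W :: "'k::finite pmf" and \<rho> \<sigma> :: "'k \<Rightarrow> ('i::finite) op"
  assumes "ereal (log 2 N) \<le> DH \<epsilon> (cq W \<rho>) (cq W \<sigma>) - ereal (1 + log 2 (1 / \<epsilon>))" "0 < \<epsilon>" "0 < N"
  obtains T where "\<And>k. povm_element (T k)"
    "1 - \<epsilon> \<le> expect W (\<lambda>k. Tr (T k) (\<rho> k))" "N * expect W (\<lambda>k. Tr (T k) (\<sigma> k)) \<le> \<epsilon>"
proof -
  obtain X where X: "povm_element X" "1 - \<epsilon> \<le> Tr X (cq W \<rho>)" "N * Tr X (cq W \<sigma>) \<le> \<epsilon>"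
    using DH_test[OF assms] by blast
  show ?thesis
  proof (rule that[of "\<lambda>k i j. X (k, i) (k, j)"])
    show "povm_element (\<lambda>i j. X (k, i) (k, j))" for k
      by (rule povm_element_reindex[OF X(1)]) (simp add: inj_def)
  qed (use X(2,3) in \<open>simp_all only: Tr_cq\<close>)
qed

lemma marginal_product_cq:
  fixes W :: "'k::finite pmf" and \<rho> :: "'k \<Rightarrow> ('i::finite) op"
  assumes "\<And>k. trace (\<rho> k) = 1"
  shows "tensor (ptrace2 (cq W \<rho>)) (ptrace1 (cq W \<rho>)) = cq W (\<lambda>_. mean_op W \<rho>)"
proof -
  have "(\<Sum>i\<in>UNIV. \<rho> k i i) = 1" for k
    using assms by (simp add: trace_def)
  then have "ptrace2 (cq W \<rho>) k k' = (if k = k' then complex_of_real (pmf W k) else 0)" for k k'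
    by (simp add: ptrace2_def cq_apply flip: sum_distrib_left)
  moreover have "ptrace1 (cq W \<rho>) i j = mean_op W \<rho> i j" for i j
    by (simp add: ptrace1_def cq_apply mean_op_eq_sum)
  ultimately show ?thesis
    by (auto simp: tensor_def cq_apply fun_eq_iff)
qed

lemma marginal_product_ccq:
  fixes \<rho> :: "'x::finite \<times> 'y::finite \<Rightarrow> ('i::finite) op"
  assumes trace: "\<And>c. trace (\<rho> c) = 1"
  shows "tensor (ptrace2 (ccq P Q \<rho>)) (ptrace1 (ccq P Q \<rho>))
    = ccq P Q (\<lambda>(x, y). mean_op P (\<lambda>x'. \<rho> (x', y)))"
proof -
  have "ptrace2 (ccq P Q \<rho>) x x' = (if x = x' then complex_of_real (pmf P x) else 0)" for x x'
  proof -
    have "ptrace2 (ccq P Q \<rho>) x x' = (\<Sum>y\<in>UNIV. \<Sum>i\<in>UNIV. ccq P Q \<rho> (x, y, i) (x', y, i))"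
      unfolding ptrace2_def UNIV_Times_UNIV[symmetric] sum.cartesian_product' ..
    also have "\<dots> = (if x = x' then complex_of_real (pmf P x) *
        (\<Sum>y\<in>UNIV. complex_of_real (pmf Q y) * trace (\<rho> (x, y))) else 0)"
      by (simp add: ccq_def cq_apply pmf_pair trace_def sum_distrib_left mult_ac)
    finally show ?thesis
      by (simp add: trace sum_complex_pmf)
  qed
  moreover have "ptrace1 (ccq P Q \<rho>) (y, i) (y', j)
      = (if y = y' then complex_of_real (pmf Q y) * mean_op P (\<lambda>x'. \<rho> (x', y)) i j else 0)"
    for y i y' j
    by (simp add: ptrace1_def ccq_def cq_apply pmf_pair mean_op_eq_sum sum_distrib_left mult_ac)
  ultimately show ?thesis
    by (auto simp: fun_eq_iff tensor_def ccq_def cq_apply pmf_pair)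
qed

lemma IH_X_YZ_le:
  fixes \<rho> :: "'x::finite \<times> 'y::finite \<Rightarrow> ('i::finite) op"
  assumes trace: "\<And>c. trace (\<rho> c) = 1"
  shows "IH_X_YZ \<epsilon> (ccq P Q \<rho>) \<le> DH \<epsilon> (cq (pair_pmf P Q) \<rho>)
    (cq (pair_pmf P Q) (\<lambda>(x, y). mean_op P (\<lambda>x'. \<rho> (x', y))))"
proof -
  define \<phi> :: "('x \<times> 'y) \<times> 'i \<Rightarrow> 'x \<times> 'y \<times> 'i" where "\<phi> = (\<lambda>((x, y), i). (x, y, i))"
  have "bij \<phi>"
    by (rule bijI') (auto simp: \<phi>_def)
  have reindex: "(\<lambda>i j. ccq P Q \<tau> (\<phi> i) (\<phi> j)) = cq (pair_pmf P Q) \<tau>" for \<tau> :: "'x \<times> 'y \<Rightarrow> 'i op"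
    by (auto simp: fun_eq_iff \<phi>_def ccq_def)
  define \<sigma> :: "'x \<times> 'y \<Rightarrow> 'i op" where "\<sigma> = (\<lambda>(x, y). mean_op P (\<lambda>x'. \<rho> (x', y)))"
  have "IH_X_YZ \<epsilon> (ccq P Q \<rho>) = DH \<epsilon> (ccq P Q \<rho>) (ccq P Q \<sigma>)"
    by (simp add: IH_X_YZ_def marginal_product_ccq[OF trace] \<sigma>_def)
  then show ?thesis
    using DH_le_reindex[OF \<open>bij \<phi>\<close>, of \<epsilon> "ccq P Q \<rho>" "ccq P Q \<sigma>"] by (simp add: reindex \<sigma>_def)
qed

lemma IH_Y_XZ_le:
  fixes \<rho> :: "'x::finite \<times> 'y::finite \<Rightarrow> ('i::finite) op"
  assumes trace: "\<And>c. trace (\<rho> c) = 1"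
  shows "IH_Y_XZ \<epsilon> (ccq P Q \<rho>) \<le> DH \<epsilon> (cq (pair_pmf P Q) \<rho>)
    (cq (pair_pmf P Q) (\<lambda>(x, y). mean_op Q (\<lambda>y'. \<rho> (x, y'))))"
proof -
  define flip :: "('x \<times> 'y \<Rightarrow> 'i op) \<Rightarrow> 'y \<times> 'x \<Rightarrow> 'i op" where "flip = (\<lambda>\<tau> (y, x). \<tau> (x, y))"
  define \<phi> :: "('x \<times> 'y) \<times> 'i \<Rightarrow> ('y \<times> 'x) \<times> 'i" where "\<phi> = (\<lambda>((x, y), i). ((y, x), i))"
  have "bij \<phi>"
    by (rule bijI') (auto simp: \<phi>_def)
  have reindex: "(\<lambda>i j. cq (pair_pmf Q P) (flip \<tau>) (\<phi> i) (\<phi> j)) = cq (pair_pmf P Q) \<tau>" for \<tau>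
    by (auto simp: fun_eq_iff \<phi>_def flip_def cq_swap[of Q P])
  define \<sigma> :: "'x \<times> 'y \<Rightarrow> 'i op" where "\<sigma> = (\<lambda>(x, y). mean_op Q (\<lambda>y'. \<rho> (x, y')))"
  have "(\<lambda>(y, x, i) (y', x', j). ccq P Q \<rho> (x, y, i) (x', y', j)) = ccq Q P (flip \<rho>)"
    by (auto simp: fun_eq_iff flip_def ccq_def cq_swap[of Q P])
  then have "IH_Y_XZ \<epsilon> (ccq P Q \<rho>) = IH_X_YZ \<epsilon> (ccq Q P (flip \<rho>))"
    by (simp add: IH_Y_XZ_def IH_X_YZ_def Let_def)
  also have "\<dots> \<le> DH \<epsilon> (cq (pair_pmf Q P) (flip \<rho>)) (cq (pair_pmf Q P) (flip \<sigma>))"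
    using IH_X_YZ_le[of "flip \<rho>" \<epsilon> Q P] trace by (simp add: flip_def \<sigma>_def split_def)
  also have "\<dots> \<le> DH \<epsilon> (cq (pair_pmf P Q) \<rho>) (cq (pair_pmf P Q) \<sigma>)"
    using DH_le_reindex[OF \<open>bij \<phi>\<close>, of \<epsilon> "cq (pair_pmf Q P) (flip \<rho>)" "cq (pair_pmf Q P) (flip \<sigma>)"]
    by (simp only: reindex)
  finally show ?thesis
    by (simp only: \<sigma>_def)
qed

lemma IH_XY_Z_eq:
  fixes \<rho> :: "'x::finite \<times> 'y::finite \<Rightarrow> ('i::finite) op"
  assumes trace: "\<And>c. trace (\<rho> c) = 1"
  shows "IH_XY_Z \<epsilon> (ccq P Q \<rho>)
    = DH \<epsilon> (cq (pair_pmf P Q) \<rho>) (cq (pair_pmf P Q) (\<lambda>_. mean_op (pair_pmf P Q) \<rho>))"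
proof -
  have "(\<lambda>((x, y), i) ((x', y'), j). ccq P Q \<rho> (x, y, i) (x', y', j)) = cq (pair_pmf P Q) \<rho>"
    by (auto simp: fun_eq_iff ccq_def)
  then show ?thesis
    using marginal_product_cq[of \<rho> "pair_pmf P Q", OF trace] by (simp add: IH_XY_Z_def)
qed

fun error_information ::
    "real \<Rightarrow> ('x::finite \<times> 'y::finite \<times> 'z::finite) op \<Rightarrow> error_kind \<Rightarrow> ereal" where
  "error_information \<epsilon> A Wrong_First = IH_X_YZ \<epsilon> A"
| "error_information \<epsilon> A Wrong_Second = IH_Y_XZ \<epsilon> A"
| "error_information \<epsilon> A Wrong_Both = IH_XY_Z \<epsilon> A"

lemma mean_op_transmitted_pmf:
  "mean_op (transmitted_pmf P Q Wrong_First c) \<rho> = mean_op P (\<lambda>x'. \<rho> (x', snd c))"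
  "mean_op (transmitted_pmf P Q Wrong_Second c) \<rho> = mean_op Q (\<lambda>y'. \<rho> (fst c, y'))"
  "mean_op (transmitted_pmf P Q Wrong_Both c) \<rho> = mean_op (pair_pmf P Q) \<rho>"
  by (cases c; simp add: mean_op_map_pmf)+

lemma error_information_le:
  fixes \<rho> :: "'x::finite \<times> 'y::finite \<Rightarrow> ('i::finite) op"
  assumes trace: "\<And>c. trace (\<rho> c) = 1"
  shows "error_information \<epsilon> (ccq P Q \<rho>) k
    \<le> DH \<epsilon> (cq (pair_pmf P Q) \<rho>) (cq (pair_pmf P Q) (\<lambda>c. mean_op (transmitted_pmf P Q k c) \<rho>))"
  using IH_X_YZ_le[OF trace, of \<epsilon> P Q] IH_Y_XZ_le[OF trace, of \<epsilon> P Q] IH_XY_Z_eq[OF trace, of \<epsilon> P Q]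
  by (cases k) (simp_all add: mean_op_transmitted_pmf split_def)

definition error_test ::
    "'x pmf \<Rightarrow> 'y pmf \<Rightarrow> ('x \<times> 'y \<Rightarrow> ('i::finite) op) \<Rightarrow> error_kind \<Rightarrow> real \<Rightarrow> real \<Rightarrow>
     ('x \<times> 'y \<Rightarrow> 'i op) \<Rightarrow> bool" where
  "error_test P Q \<rho> k N \<epsilon> T \<longleftrightarrow> (\<forall>c. povm_element (T c)) \<and>
     1 - \<epsilon> \<le> expect (pair_pmf P Q) (\<lambda>c. Tr (T c) (\<rho> c)) \<and>
     N * expect (pair_pmf P Q) (\<lambda>c'. expect (transmitted_pmf P Q k c') (\<lambda>c. Tr (T c') (\<rho> c))) \<le> \<epsilon>"

lemma error_test_exists:
  fixes \<rho> :: "'x::finite \<times> 'y::finite \<Rightarrow> ('i::finite) op"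
  assumes trace: "\<And>c. trace (\<rho> c) = 1"
    and le: "ereal (log 2 N) \<le> error_information \<epsilon> (ccq P Q \<rho>) k - ereal (1 + log 2 (1 / \<epsilon>))"
    and "0 < \<epsilon>" "0 < N"
  shows "\<exists>T. error_test P Q \<rho> k N \<epsilon> T"
proof -
  have "error_information \<epsilon> (ccq P Q \<rho>) k
      \<le> DH \<epsilon> (cq (pair_pmf P Q) \<rho>) (cq (pair_pmf P Q) (\<lambda>c. mean_op (transmitted_pmf P Q k c) \<rho>))"
    by (rule error_information_le[OF trace])
  with le have "ereal (log 2 N) \<le> DH \<epsilon> (cq (pair_pmf P Q) \<rho>)
      (cq (pair_pmf P Q) (\<lambda>c. mean_op (transmitted_pmf P Q k c) \<rho>)) - ereal (1 + log 2 (1 / \<epsilon>))"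
    by (rule order_trans[OF _ ereal_minus_mono]) simp
  then show ?thesis
    by (rule cq_test[OF _ assms(3,4)]) (auto simp: error_test_def Tr_mean_op intro!: exI)
qed

lemma mac_state_eq_ccq:
  "mac_state (pmf P) (pmf Q) \<sigma>X \<sigma>Y C = ccq P Q (\<lambda>(x, y). C (tensor (\<sigma>X x) (\<sigma>Y y)))"
proof -
  define A where "A = ccq P Q (\<lambda>(x, y). C (tensor (\<sigma>X x) (\<sigma>Y y)))"
  have "mac_state (pmf P) (pmf Q) \<sigma>X \<sigma>Y C (x, y, i) (x', y', j) = A (x, y, i) (x', y', j)"
    for x y i x' y' j
  proof -
    have "mac_state (pmf P) (pmf Q) \<sigma>X \<sigma>Y C (x, y, i) (x', y', j)
        = (\<Sum>s\<in>UNIV. \<Sum>t\<in>UNIV. if t = y then if s = x then A (x, y, i) (x', y', j) else 0 else 0)"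
      unfolding mac_state_def A_def
      by (intro sum.cong refl) (auto simp: tensor_def proj_def ccq_def cq_apply pmf_pair)
    then show ?thesis
      by simp
  qed
  then show ?thesis
    by (auto simp: fun_eq_iff A_def)
qed

section \<open>The coding theorem\<close>

lemma tilt_optimization:
  fixes s :: real
  assumes "0 < s" "49 * s < 1"
  shows "32 * (1 + 4 * s)\<^sup>2 / (4 * s) * (3 * s\<^sup>2) + 4 * (4 * s) + 3 * (8 * (1 + 4 * s)) * s\<^sup>2
    \<le> 49 * s"
proof -
  have "s * s \<le> s * (1 / 49)"
    using assms by (intro mult_left_mono) auto
  moreover have "s * s * s \<le> s * (1 / 49) * (1 / 49)"
    using assms by (intro mult_mono) auto
  moreover have
    "32 * (1 + 4 * s)\<^sup>2 / (4 * s) * (3 * s\<^sup>2) + 4 * (4 * s) + 3 * (8 * (1 + 4 * s)) * s\<^sup>2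
      = 40 * s + 216 * (s * s) + 480 * (s * s * s)"
    using assms(1) by (simp add: field_simps power2_eq_square)
  ultimately show ?thesis
    using assms(1) by linarith
qed

definition decodes ::
    "nat \<Rightarrow> nat \<Rightarrow> (nat \<times> nat \<Rightarrow> ('i::finite) op) \<Rightarrow> real \<Rightarrow> (nat \<times> nat \<Rightarrow> 'i op) \<Rightarrow> bool" where
  "decodes M1 M2 \<tau> \<eta> \<Lambda> \<longleftrightarrow> (\<forall>m\<in>{..<M1} \<times> {..<M2}. psd (\<Lambda> m)) \<and>
     (\<forall>i j. (\<Sum>m\<in>{..<M1} \<times> {..<M2}. \<Lambda> m i j) = idop i j) \<and>
     (\<Sum>m\<in>{..<M1} \<times> {..<M2}. 1 - Tr (\<Lambda> m) (\<tau> m)) / (real M1 * real M2) \<le> \<eta>"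

lemma exists_trivial_decoder:
  assumes "0 < M1" "0 < M2" "\<And>m. density (\<tau> m)" "1 \<le> \<eta>"
  shows "\<exists>\<Lambda>. decodes M1 M2 \<tau> \<eta> \<Lambda>"
proof -
  let ?I = "{..<M1} \<times> {..<M2}"
  define \<Lambda> :: "nat \<times> nat \<Rightarrow> 'a op" where "\<Lambda> = (\<lambda>m. if m = (0, 0) then idop else (\<lambda>i j. 0))"
  have \<Lambda>: "psd (\<Lambda> m)" for m
    by (simp add: \<Lambda>_def psd_idop psd_zero)
  have "(\<Sum>m\<in>?I. \<Lambda> m i j) = (\<Sum>m\<in>?I. if m = (0, 0) then idop i j else 0)" for i j
    by (intro sum.cong) (auto simp: \<Lambda>_def)
  then have total: "(\<Sum>m\<in>?I. \<Lambda> m i j) = idop i j" for i j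
    using assms(1,2) by simp
  have "(\<Sum>m\<in>?I. 1 - Tr (\<Lambda> m) (\<tau> m)) \<le> (\<Sum>m\<in>?I. 1)"
    using \<Lambda> assms(3) by (intro sum_mono) (simp add: Tr_nonneg density_def)
  then have "(\<Sum>m\<in>?I. 1 - Tr (\<Lambda> m) (\<tau> m)) / (real M1 * real M2) \<le> 1"
    using assms(1,2) by (simp add: divide_le_eq)
  then show ?thesis
    using \<Lambda> total assms(4) unfolding decodes_def by (intro exI[of _ \<Lambda>]) simp
qed

lemma error_test_povm_element: "error_test P Q \<rho> k N \<epsilon> T \<Longrightarrow> povm_element (T c)"
  unfolding error_test_def by blast

lemma expect_sum_reject_le:
  fixes P :: "'x::finite pmf" and Q :: "'y::finite pmf"
  assumes "\<And>k. error_test P Q \<rho> k (N k) \<epsilon> (T k)"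
  shows "expect (pair_pmf P Q) (\<lambda>c. \<Sum>k\<in>UNIV. 1 - Tr (T k c) (\<rho> c)) \<le> 3 * \<epsilon>"
proof -
  have "1 - \<epsilon> \<le> expect (pair_pmf P Q) (\<lambda>c. Tr (T k c) (\<rho> c))" for k
    using assms[of k] unfolding error_test_def by blast
  then have "(\<Sum>k\<in>UNIV. 1 - expect (pair_pmf P Q) (\<lambda>c. Tr (T k c) (\<rho> c)))
      \<le> (\<Sum>k\<in>(UNIV :: error_kind set). \<epsilon>)"
    by (intro sum_mono) (simp add: algebra_simps)
  then show ?thesis
    by (simp add: UNIV_error_kind)
qed

lemma good_codebook_exists:
  fixes P :: "'x::finite pmf" and Q :: "'y::finite pmf" and \<rho> :: "'x \<times> 'y \<Rightarrow> ('i::finite) op"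
  assumes M: "0 < M1" "0 < M2" and \<rho>: "\<And>c. density (\<rho> c)"
    and error_test: "\<And>k. error_test P Q \<rho> k (num_competitors M1 M2 k) \<epsilon> (T k)"
    and "0 \<le> a" "0 \<le> K"
  shows "\<exists>c. (\<Sum>m\<in>{..<M1} \<times> {..<M2}.
      (a * (\<Sum>k\<in>UNIV. 1 - Tr (T k (codeword c m)) (\<rho> (codeword c m))) + b)
      + K * (\<Sum>m'\<in>{..<M1} \<times> {..<M2} - {m}.
          Tr (T (error_kind_of m m') (codeword c m')) (\<rho> (codeword c m)))) / (real M1 * real M2)
    \<le> a * (3 * \<epsilon>) + b + 3 * K * \<epsilon>"
proof -
  define h where "h = (\<lambda>c. a * (\<Sum>k\<in>UNIV. 1 - Tr (T k c) (\<rho> c)) + b)"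
  have h_le: "expect (pair_pmf P Q) h \<le> a * (3 * \<epsilon>) + b"
    using mult_left_mono[OF expect_sum_reject_le[OF error_test] \<open>0 \<le> a\<close>] by (simp add: h_def)
  have nonneg: "0 \<le> Tr (T k c') (\<rho> c)" for k c' c
    using error_test_povm_element[OF error_test] \<rho>
    by (simp add: Tr_nonneg povm_element_def density_def)
  have sound: "num_competitors M1 M2 k * expect (pair_pmf P Q)
      (\<lambda>c'. expect (transmitted_pmf P Q k c') (\<lambda>c. Tr (T k c') (\<rho> c))) \<le> \<epsilon>" for k
    using error_test[of k] unfolding error_test_def by blast
  show ?thesis
    by (rule random_codebook[of M1 M2 K "\<lambda>k c' c. Tr (T k c') (\<rho> c)" P Q h _ \<epsilon>,
          OF M \<open>0 \<le> K\<close> nonneg h_le sound])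
      (unfold h_def, rule exI)
qed

lemma random_coding_small_error:
  fixes P :: "'x::finite pmf" and Q :: "'y::finite pmf" and \<rho> :: "'x \<times> 'y \<Rightarrow> ('i::finite) op"
  assumes M: "0 < M1" "0 < M2" and \<rho>: "\<And>c. density (\<rho> c)"
    and error_test: "\<And>k. error_test P Q \<rho> k (num_competitors M1 M2 k) \<epsilon> (T k)"
    and \<epsilon>: "0 < \<epsilon>" "49 * sqrt \<epsilon> < 1"
  shows "\<exists>c \<Lambda>. decodes M1 M2 (\<lambda>m. \<rho> (codeword c m)) (49 * sqrt \<epsilon>) \<Lambda>"
proof -
  let ?I = "{..<M1} \<times> {..<M2}"
  have I: "finite ?I" "?I \<noteq> {}"
    using M by (auto simp: lessThan_empty_iff)
  define s \<delta> where "s = sqrt \<epsilon>" and "\<delta> = sqrt (4 * s)"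
  have s: "0 < s" "49 * s < 1" "s\<^sup>2 = \<epsilon>"
    using \<epsilon> by (auto simp: s_def)
  then have \<delta>: "0 < \<delta>" "\<delta> \<le> 1" "\<delta>\<^sup>2 = 4 * s"
    by (auto simp: \<delta>_def)
  define a K where "a = 32 * (1 + \<delta>\<^sup>2)\<^sup>2 / \<delta>\<^sup>2" and "K = 8 * (1 + \<delta>\<^sup>2)"
  have "0 \<le> a" "0 \<le> K"
    by (auto simp: a_def K_def)
  with good_codebook_exists[OF M \<rho> error_test, of a K "4 * \<delta>\<^sup>2"] obtain c where codebook:
    "(\<Sum>m\<in>?I. (a * (\<Sum>k\<in>UNIV. 1 - Tr (T k (codeword c m)) (\<rho> (codeword c m))) + 4 * \<delta>\<^sup>2)
      + K * (\<Sum>m'\<in>?I - {m}. Tr (T (error_kind_of m m') (codeword c m')) (\<rho> (codeword c m))))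
      / (real M1 * real M2) \<le> a * (3 * \<epsilon>) + 4 * \<delta>\<^sup>2 + 3 * K * \<epsilon>"
    by blast
  show ?thesis
  proof (rule tilted_povm[of ?I "\<lambda>k m. T k (codeword c m)" \<delta>,
        OF I error_test_povm_element[OF error_test] \<delta>(1,2)])
    fix \<Lambda>
    assume \<Lambda>: "\<And>m. m \<in> ?I \<Longrightarrow> psd (\<Lambda> m)" "\<And>i j. (\<Sum>m\<in>?I. \<Lambda> m i j) = idop i j"
      and miss: "\<And>m \<tau>. m \<in> ?I \<Longrightarrow> density \<tau> \<Longrightarrow> 1 - Tr (\<Lambda> m) \<tau>
        \<le> 32 * (1 + \<delta>\<^sup>2)\<^sup>2 / \<delta>\<^sup>2 * (\<Sum>k\<in>UNIV. 1 - Tr (T k (codeword c m)) \<tau>)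
          + 8 * (1 + \<delta>\<^sup>2) * (\<Sum>m'\<in>?I - {m}. Tr (T (error_kind_of m m') (codeword c m')) \<tau>) + 4 * \<delta>\<^sup>2"
    have "(\<Sum>m\<in>?I. 1 - Tr (\<Lambda> m) (\<rho> (codeword c m))) / (real M1 * real M2)
        \<le> a * (3 * \<epsilon>) + 4 * \<delta>\<^sup>2 + 3 * K * \<epsilon>"
      using miss[OF _ \<rho>] unfolding a_def[symmetric] K_def[symmetric]
      by (intro order_trans[OF divide_right_mono[OF sum_mono] codebook])
        (simp_all add: algebra_simps)
    also have "\<dots> \<le> 49 * sqrt \<epsilon>"
      using tilt_optimization[OF s(1,2)] by (simp only: a_def K_def \<delta>(3) s(3) flip: s_def)
    finally show ?thesis
      using \<Lambda> unfolding decodes_def by blast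
  qed
qed

lemma random_coding:
  fixes P :: "'x::finite pmf" and Q :: "'y::finite pmf" and \<rho> :: "'x \<times> 'y \<Rightarrow> ('i::finite) op"
  assumes "0 < M1" "0 < M2" "\<And>c. density (\<rho> c)"
    and "\<And>k. error_test P Q \<rho> k (num_competitors M1 M2 k) \<epsilon> (T k)" "0 < \<epsilon>"
  shows "\<exists>c \<Lambda>. decodes M1 M2 (\<lambda>m. \<rho> (codeword c m)) (49 * sqrt \<epsilon>) \<Lambda>"
proof (cases "49 * sqrt \<epsilon> < 1")
  case True
  then show ?thesis
    by (rule random_coding_small_error[OF assms])
next
  case False
  have "\<exists>\<Lambda>. decodes M1 M2 (\<lambda>m. \<rho> (codeword c m)) (49 * sqrt \<epsilon>) \<Lambda>" for c
    by (rule exists_trivial_decoder[OF assms(1-3)]) (use False in simp)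
  then show ?thesis
    by blast
qed

lemma mac_codeI:
  assumes "\<And>m. density (\<alpha> m)" "\<And>m. density (\<beta> m)" "\<And>m n. density (C (tensor (\<alpha> m) (\<beta> n)))"
    and "decodes M1 M2 (\<lambda>(m, n). C (tensor (\<alpha> m) (\<beta> n))) \<eta> \<Lambda>"
  shows "mac_code C M1 M2 \<eta> \<alpha> \<beta> (\<lambda>m n. \<Lambda> (m, n))"
  using assms unfolding mac_code_def decodes_def
  by (simp add: sum.cartesian_product split_def Tr_compl flip: Tr_def)

lemma exists_pmf_eq:
  fixes p :: "'a::finite \<Rightarrow> real"
  assumes "\<forall>x. p x \<ge> 0" "(\<Sum>x\<in>UNIV. p x) = 1"
  shows "\<exists>P. p = pmf P"
proof
  have "(\<integral>\<^sup>+ x. ennreal (p x) \<partial>count_space UNIV) = 1"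
    using assms by (simp add: nn_integral_count_space_finite)
  then show "p = pmf (embed_pmf p)"
    using assms(1) by (simp add: fun_eq_iff pmf_embed_pmf)
qed

theorem theorem1:
  fixes C :: "('a::finite \<times> 'b::finite) op \<Rightarrow> ('z::finite) op"
    and p :: "'x::finite \<Rightarrow> real" and q :: "'y::finite \<Rightarrow> real"
    and \<sigma>X :: "'x \<Rightarrow> 'a op" and \<sigma>Y :: "'y \<Rightarrow> 'b op"
    and \<epsilon> :: real and M1 M2 :: nat
  assumes "quantum_channel C"
    and "\<forall>x. density (\<sigma>X x)" and "\<forall>y. density (\<sigma>Y y)"
    and "\<forall>x. p x \<ge> 0" and "(\<Sum>x\<in>UNIV. p x) = 1"
    and "\<forall>y. q y \<ge> 0" and "(\<Sum>y\<in>UNIV. q y) = 1"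
    and "0 < \<epsilon>" and "\<epsilon> < 1"
    and "M1 \<ge> 1" and "M2 \<ge> 1"
    and "ereal (log 2 M1) \<le> IH_X_YZ \<epsilon> (mac_state p q \<sigma>X \<sigma>Y C) - ereal (1 + log 2 (1 / \<epsilon>))"
    and "ereal (log 2 M2) \<le> IH_Y_XZ \<epsilon> (mac_state p q \<sigma>X \<sigma>Y C) - ereal (1 + log 2 (1 / \<epsilon>))"
    and "ereal (log 2 M1 + log 2 M2) \<le> IH_XY_Z \<epsilon> (mac_state p q \<sigma>X \<sigma>Y C) - ereal (1 + log 2 (1 / \<epsilon>))"
  shows "\<exists>\<alpha> \<beta> \<Lambda>. mac_code C M1 M2 (49 * sqrt \<epsilon>) \<alpha> \<beta> \<Lambda>"
proof -
  obtain P Q where p: "p = pmf P" and q: "q = pmf Q"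
    using exists_pmf_eq[OF assms(4,5)] exists_pmf_eq[OF assms(6,7)] by blast
  have M: "0 < M1" "0 < M2"
    using assms(10,11) by simp_all
  define \<rho> where "\<rho> = (\<lambda>(x, y). C (tensor (\<sigma>X x) (\<sigma>Y y)))"
  have \<rho>: "density (\<rho> c)" for c
    using assms(1-3) by (simp add: \<rho>_def split_def density_quantum_channel density_tensor)
  have state: "mac_state p q \<sigma>X \<sigma>Y C = ccq P Q \<rho>"
    by (simp only: p q \<rho>_def mac_state_eq_ccq)
  have rates: "ereal (log 2 (num_competitors M1 M2 k))
      \<le> error_information \<epsilon> (mac_state p q \<sigma>X \<sigma>Y C) k - ereal (1 + log 2 (1 / \<epsilon>))" for k
    using assms(10-14) by (cases k) (simp_all add: log_mult)
  have "\<exists>T. error_test P Q \<rho> k (num_competitors M1 M2 k) \<epsilon> T" for k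
    by (rule error_test_exists[OF _ rates[unfolded state] \<open>0 < \<epsilon>\<close>])
      (use \<rho> in \<open>simp_all add: density_def num_competitors_pos M\<close>)
  then obtain T where "\<And>k. error_test P Q \<rho> k (num_competitors M1 M2 k) \<epsilon> (T k)"
    by metis
  then obtain c \<Lambda> where "decodes M1 M2 (\<lambda>m. \<rho> (codeword c m)) (49 * sqrt \<epsilon>) \<Lambda>"
    using random_coding[of M1 M2 \<rho> P Q \<epsilon> T, OF M \<rho> _ \<open>0 < \<epsilon>\<close>] by blast
  then have "mac_code C M1 M2 (49 * sqrt \<epsilon>) (\<lambda>m. \<sigma>X (fst c m)) (\<lambda>n. \<sigma>Y (snd c n)) (\<lambda>m n. \<Lambda> (m, n))"
    using assms(2,3) \<rho> by (intro mac_codeI) (auto simp: \<rho>_def codeword_def split_def)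
  then show ?thesis
    by blast
qed

end
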